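(* For all integers $N,d\ge 2$, \[ \sup_{\rho\in \mathrm{EXCH}_N^{(2)}(d)}\ \inf_{\tau\in \mathrm{SEP}_{\mathrm P}^{(2)}(d)}\ \tfrac12\|\rho-\tau\|_1\ \le\ \frac{\sqrt{d^2-1}}{2(N-1)} . \]
   Context: $\mathrm D(\mathcal H)$ denotes the density operators on a finite-dimensional complex Hilbert space $\mathcal H$, and $\|\cdot\|_1$ is the trace norm. For $\pi\in\mathfrak S_N$, $U_\pi$ is the unitary permuting the tensor factors of $(\mathbb C^d)^{\otimes N}$. For a state $\sigma_N$ on $(\mathbb C^d)^{\otimes N}$, $\sigma_N^{(t)}$ is its marginal on the first $t$ tensor factors. $\mathrm{EXCH}_N^{(2)}(d):=\{\sigma_N^{(2)}:\sigma_N\in\mathrm D((\mathbb C^d)^{\otimes N}),\ U_\pi\sigma_NU_\pi^\dagger=\sigma_N\ \text{for every }\pi\in\mathfrak S_N\}$. $\mathrm{SEP}_{\mathrm P}^{(2)}(d):=\mathrm{conv}\{\sigma^{\otimes 2}:\sigma\in\mathrm D(\mathbb C^d)\}$ (tensor-power mixtures). *)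

theory Defs
  imports "HOL-Analysis.Analysis" "HOL-Library.Numeral_Type"
begin

text \<open>
  Operators are complex matrices. The space \<open>\<complex>\<^sup>d\<close> has the basis type \<open>'d\<close>, with
  \<open>d = CARD('d)\<close>. The tensor power \<open>(\<complex>\<^sup>d)\<^sup>\<otimes>\<^sup>N\<close> has as basis type the tuples \<open>'n \<Rightarrow> 'd\<close>,
  with \<open>N = CARD('n)\<close>; the function \<open>x\<close> stands for the tensor product of the basis vectors
  \<open>x k\<close>, \<open>k :: 'n\<close>. A linear order on \<open>'n\<close> says which tensor factors come first.
\<close>

definition dagger :: "complex^'j^'i \<Rightarrow> complex^'i^'j" where
  "dagger A = (\<chi> i j. cnj (A $ j $ i))"

definition psd :: "complex^'i^'i \<Rightarrow> bool" where
  "psd A \<longleftrightarrow> dagger A = A \<and> (\<forall>v. 0 \<le> Re (\<Sum>i\<in>UNIV. cnj (v $ i) * (A *v v) $ i))"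

definition density :: "complex^'i^'i \<Rightarrow> bool" where
  "density A \<longleftrightarrow> psd A \<and> trace A = 1"

text \<open>A positive semidefinite matrix has exactly one positive semidefinite square root;
  \<open>psd_sqrt\<close> is used for such matrices only.\<close>

definition psd_sqrt :: "complex^'i^'i \<Rightarrow> complex^'i^'i" where
  "psd_sqrt A = (THE B. psd B \<and> B ** B = A)"

definition trace_norm :: "complex^'i^'i \<Rightarrow> real" where
  "trace_norm A = Re (trace (psd_sqrt (dagger A ** A)))"

text \<open>\<open>perm_op \<pi>\<close> sends the basis vector \<open>y\<close> to \<open>y \<circ> inv \<pi>\<close>: the content of factor \<open>k\<close> is
  moved to factor \<open>\<pi> k\<close>.\<close>

definition perm_op :: "('n::finite \<Rightarrow> 'n) \<Rightarrow> complex^('n \<Rightarrow> 'd::finite)^('n \<Rightarrow> 'd)" where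
  "perm_op \<pi> = (\<chi> x y. if x = y \<circ> inv \<pi> then 1 else 0)"

definition perm_invariant :: "complex^('n::finite \<Rightarrow> 'd::finite)^('n \<Rightarrow> 'd) \<Rightarrow> bool" where
  "perm_invariant \<sigma> \<longleftrightarrow>
     (\<forall>\<pi>. \<pi> permutes UNIV \<longrightarrow> perm_op \<pi> ** \<sigma> ** dagger (perm_op \<pi>) = \<sigma>)"

text \<open>The \<open>k\<close>-th smallest element of \<open>'t\<close> goes to the \<open>k\<close>-th smallest element of \<open>'n\<close>, so for
  \<open>CARD('t) \<le> CARD('n)\<close> the range consists of the first \<open>CARD('t)\<close> factors.\<close>

definition first_factors :: "'t::{finite,linorder} \<Rightarrow> 'n::{finite,linorder}" where
  "first_factors i = sorted_list_of_set UNIV ! card {j. j < i}"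

text \<open>The partial trace over all factors but the first \<open>CARD('t)\<close>, where
  \<open>CARD('t) \<le> CARD('n)\<close>: the sum runs over the pairs \<open>x\<close>, \<open>y\<close> of tuples that extend \<open>a\<close>, \<open>b\<close>
  respectively and agree on the factors traced out.\<close>

definition marginal ::
  "complex^('n::{finite,linorder} \<Rightarrow> 'd::finite)^('n \<Rightarrow> 'd)
     \<Rightarrow> complex^('t::{finite,linorder} \<Rightarrow> 'd)^('t \<Rightarrow> 'd)" where
  "marginal \<sigma> = (\<chi> a b. \<Sum>(x, y) \<in> {(x, y). x \<circ> first_factors = a \<and> y \<circ> first_factors = b \<and>
       (\<forall>k. k \<notin> range (first_factors :: 't \<Rightarrow> 'n) \<longrightarrow> x k = y k)}. \<sigma> $ x $ y)"

definition tensor_power :: "complex^'d^'d \<Rightarrow> complex^('t::finite \<Rightarrow> 'd::finite)^('t \<Rightarrow> 'd)" where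
  "tensor_power \<sigma> = (\<chi> x y. \<Prod>k\<in>UNIV. \<sigma> $ (x k) $ (y k))"

definition EXCH2 ::
  "'n::{finite,linorder} itself \<Rightarrow> (complex^(2 \<Rightarrow> 'd::finite)^(2 \<Rightarrow> 'd)) set" where
  "EXCH2 _ = {marginal \<sigma> | \<sigma> :: complex^('n \<Rightarrow> 'd)^('n \<Rightarrow> 'd). density \<sigma> \<and> perm_invariant \<sigma>}"

definition SEP2 :: "(complex^(2 \<Rightarrow> 'd::finite)^(2 \<Rightarrow> 'd)) set" where
  "SEP2 = convex hull {tensor_power \<sigma> | \<sigma>. density \<sigma>}"

end

theory Submission imports Defs begin

text \<open>
  Suppose an exchangeable \<open>\<rho>\<close> is not of the form \<open>\<tau> + c (\<omega>\<^sub>1 - \<omega>\<^sub>2)\<close> with \<open>\<tau>\<close> in \<open>SEP2\<close>, density matrices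
  \<open>\<omega>\<^sub>1, \<omega>\<^sub>2\<close> and \<open>c = sqrt (d\<^sup>2 - 1) / (2 (N - 1))\<close>. These operators form a compact convex set, so a
  Hermitian \<open>H\<close> separates: \<open>tr H \<rho> > e + c (r - l)\<close>, where \<open>l, r\<close> are the extreme eigenvalues of \<open>H\<close> and
  \<open>e\<close> is the maximum of \<open>tr H \<omega>\<^sup>\<otimes>\<^sup>2\<close>.

  This is impossible. Purify to a symmetric vector of \<open>(\<complex>\<^sup>D)\<^sup>\<otimes>\<^sup>N\<close> with \<open>D = d\<^sup>2\<close>, and let \<open>\<Psi>\<close> maximise the energy
  \<open>E\<close> of \<open>K = H \<otimes> 1\<close>, acting on two sites, among symmetric unit vectors. Choose a unit vector \<open>u\<close> for which
  \<open>f(u) = \<langle>\<Psi>, u\<^sup>\<otimes>\<^sup>N\<rangle>\<close> is largest in modulus. Stationarity of \<open>\<Psi>\<close> tested on \<open>u\<^sup>\<otimes>\<^sup>N\<close> gives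
  \<open>E f(u) = \<langle>\<Psi>, K(u \<otimes> u) \<otimes> u\<^sup>\<otimes>\<^sup>(\<^sup>N\<^sup>-\<^sup>2\<^sup>)\<rangle>\<close>. The first and second order conditions at \<open>u\<close> say that
  contracting \<open>\<Psi>\<close> with \<open>u\<^sup>\<otimes>\<^sup>(\<^sup>N\<^sup>-\<^sup>2\<^sup>)\<close> and dividing by \<open>f(u)\<close> leaves \<open>u \<otimes> u\<close> plus a symmetric tensor \<open>A\<close>
  on the complement of \<open>u\<close> of operator norm at most \<open>1 / (N - 1)\<close>, hence of Hilbert-Schmidt norm at most
  \<open>sqrt (D - 1) / (N - 1)\<close>. As \<open>A\<close> is orthogonal to \<open>u \<otimes> u\<close>, only \<open>K - (l + r) / 2\<close> matters in the
  \<open>A\<close>-term, so \<open>E \<le> e + (r - l) / 2 * sqrt (D - 1) / (N - 1)\<close>.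
\<close>

section \<open>Spectral theorem and trace norm\<close>

text \<open>The Hermitian form whose real part is \<open>inner\<close> on \<open>complex^'i\<close>.
  Compactness and maximisation use \<open>inner\<close>; orthogonality over the complex numbers and
  phases use \<open>cip\<close>.\<close>

definition cip :: "complex^'i \<Rightarrow> complex^'i \<Rightarrow> complex" where
  "cip v w = (\<Sum>i\<in>UNIV. cnj (v $ i) * w $ i)"

lemma inner_eq_Re_cip: "inner v w = Re (cip v w)"
  by (simp add: inner_vec_def cip_def inner_complex_def)

lemma cip_commute: "cip w v = cnj (cip v w)"
  by (simp add: cip_def mult.commute)

lemma cip_add_right: "cip v (x + y) = cip v x + cip v y"
  and cip_diff_right: "cip v (x - y) = cip v x - cip v y"
  and cip_scale_right: "cip v (c *s x) = c * cip v x"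
  and cip_scale_left: "cip (c *s v) x = cnj c * cip v x"
  and cip_diff_left: "cip (v - w) x = cip v x - cip w x"
  by (simp_all add: cip_def algebra_simps sum.distrib sum_subtractf sum_distrib_left)

lemma cip_sum_right: "cip v (sum f S) = (\<Sum>s\<in>S. cip v (f s))"
  by (induction S rule: infinite_finite_induct) (auto simp: cip_add_right, simp_all add: cip_def)

lemma cip_self: "cip v v = of_real ((norm v)\<^sup>2)"
proof -
  have "Im (cip v v) = 0"
    by (simp add: cip_def)
  moreover have "Re (cip v v) = (norm v)\<^sup>2"
    by (simp add: inner_eq_Re_cip[symmetric] dot_square_norm)
  ultimately show ?thesis
    by (simp add: complex_eq_iff)
qed

lemma scaleR_eq_vector_scalar: "r *\<^sub>R v = complex_of_real r *s (v :: complex^'i)"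
  by (simp add: vec_eq_iff vector_scaleR_component) (simp add: scaleR_conv_of_real)

lemma norm_vector_scalar: "norm (c *s (v :: complex^'i)) = norm c * norm v"
  by (simp add: norm_vec_def norm_mult L2_set_right_distrib)

lemma inner_ii_left: "inner (\<i> *s v) w = Im (cip v w)"
  by (simp add: inner_eq_Re_cip cip_scale_left)

lemma cip_matrix_vector: "cip v (A *v w) = cip (dagger A *v v) w"
  unfolding cip_def dagger_def matrix_vector_mult_def
  by (simp add: sum_distrib_left sum_distrib_right, subst sum.swap, simp add: algebra_simps)

lemma inner_matrix_vector: "inner v ((A :: complex^'i^'j) *v w) = inner (dagger A *v v) w"
  by (simp add: inner_eq_Re_cip cip_matrix_vector)

lemma psd_iff: "psd A \<longleftrightarrow> dagger A = A \<and> (\<forall>v. 0 \<le> inner v (A *v v))"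
  by (simp add: psd_def inner_eq_Re_cip cip_def)

lemma linear_matrix_vector: "linear (\<lambda>v. (A :: complex^'i^'j) *v v)"
  by (auto intro!: linearI simp: matrix_vector_mult_def vec_eq_iff algebra_simps sum.distrib
      scaleR_sum_right)

section \<open>Rayleigh quotients and eigenbases\<close>

text \<open>The Rayleigh quotient attains its maximum \<mu> on the compact unit sphere of
  \<open>V\<close>, and the first-order condition there is the last conclusion. As \<open>f\<close>
  need not preserve \<open>V\<close>, that condition is tested against \<open>V\<close> only. It
  serves twice: for eigenvectors, and for the energy on symmetric tensors.\<close>

lemma self_adjoint_max_on_subspace:
  fixes f :: "'a::euclidean_space \<Rightarrow> 'a"
  assumes f: "linear f" "\<And>x y. inner x (f y) = inner (f x) y"
    and V: "subspace V" "v0 \<in> V" "v0 \<noteq> 0"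
  obtains v \<mu> where "v \<in> V" "norm v = 1" "\<And>w. w \<in> V \<Longrightarrow> inner w (f w) \<le> \<mu> * inner w w"
    "\<And>w. w \<in> V \<Longrightarrow> inner w (f v) = \<mu> * inner w v"
proof -
  let ?S = "sphere 0 1 \<inter> V"
  interpret f: linear f by fact
  have "compact ?S"
    by (intro compact_Int_closed compact_sphere closed_subspace V)
  moreover have "(1 / norm v0) *\<^sub>R v0 \<in> ?S"
    using V by (auto intro: subspace_scale)
  moreover have "continuous_on ?S (\<lambda>v. inner v (f v))"
    by (intro continuous_intros linear_continuous_on linear_linear[THEN iffD2] f)
  ultimately obtain v where v: "v \<in> ?S" and max: "\<And>w. w \<in> ?S \<Longrightarrow> inner w (f w) \<le> inner v (f v)"
    using continuous_attains_sup[of ?S "\<lambda>v. inner v (f v)"] by blast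
  define \<mu> where "\<mu> = inner v (f v)"
  have vv: "inner v v = 1"
    using v by (simp add: dot_square_norm)
  have le: "inner w (f w) \<le> \<mu> * inner w w" if "w \<in> V" for w
  proof (cases "w = 0")
    case False
    have "(1 / norm w) *\<^sub>R w \<in> ?S"
      using False V that by (auto intro: subspace_scale)
    from max[OF this] have "inner w (f w) / (norm w)\<^sup>2 \<le> \<mu>"
      by (simp add: \<mu>_def f.scaleR power2_eq_square)
    then show ?thesis
      using False by (simp add: divide_simps dot_square_norm)
  qed (simp add: f.zero)
  have stat: "inner w (f v) = \<mu> * inner w v" if w: "w \<in> V" for w
  proof -
    define b where "b = inner w (f v) - \<mu> * inner w v"
    define c where "c = \<mu> * inner w w - inner w (f w)"
    have quad: "2 * t * b \<le> t\<^sup>2 * c" for t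
    proof -
      have "v + t *\<^sub>R w \<in> V"
        using V v w by (auto intro: subspace_add subspace_scale)
      from le[OF this] show ?thesis
        using f(2)[of v w] vv
        by (simp add: f.add f.scaleR b_def c_def \<mu>_def[symmetric] inner_add_left inner_add_right
            algebra_simps inner_commute power2_eq_square)
    qed
    have "b = 0"
    proof (rule ccontr)
      assume b: "b \<noteq> 0"
      \<comment> \<open>A positive bound for \<open>c\<close>: with t = b / k the quadratic
        inequality becomes 2 b^2 / k \<le> b^2 / k, which forces b = 0.\<close>
      define k where "k = \<bar>c\<bar> + 1"
      have k: "0 < k" "c \<le> k" by (auto simp: k_def)
      have "2 * (b / k) * b \<le> (b / k)\<^sup>2 * c" by (rule quad)
      also have "\<dots> \<le> (b / k)\<^sup>2 * k"
        using k by (intro mult_left_mono) auto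
      finally have "b\<^sup>2 \<le> 0"
        using k by (simp add: power2_eq_square field_simps)
      then show False using b by simp
    qed
    then show ?thesis by (simp add: b_def)
  qed
  show thesis
    using that[of v \<mu>] v le stat by auto
qed

definition complex_onb :: "(complex^'i) set \<Rightarrow> bool" where
  "complex_onb S \<longleftrightarrow> finite S \<and> (\<forall>s\<in>S. \<forall>t\<in>S. cip s t = (if s = t then 1 else 0)) \<and>
     (\<forall>v. (\<Sum>s\<in>S. cip s v *s s) = v)"

text \<open>Take an orthonormal family of eigenvectors with real eigenvalues of the largest possible
  cardinality. If its orthogonal complement were nonzero, a maximiser of the Rayleigh quotient there
  would be a further eigenvector.\<close>

theorem hermitian_spectral:
  fixes A :: "complex^'i^'i"
  assumes A: "dagger A = A"
  obtains S \<mu> where "complex_onb S" "\<And>s. s \<in> S \<Longrightarrow> A *v s = complex_of_real (\<mu> s) *s s"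
proof -
  define P where "P S \<longleftrightarrow> finite S \<and> (\<forall>s\<in>S. \<forall>t\<in>S. cip s t = (if s = t then 1 else 0)) \<and>
      (\<forall>s\<in>S. \<exists>\<mu>. A *v s = complex_of_real \<mu> *s s)" for S
  \<comment> \<open>Complex orthonormality implies real orthogonality, so the real dimension bounds
    the cardinality. This crude bound already makes a largest family exist.\<close>
  have bound: "card S < DIM(complex^'i) + 1" if "P S" for S
  proof -
    have "pairwise orthogonal S"
      using that by (auto simp: P_def pairwise_def orthogonal_def inner_eq_Re_cip)
    moreover have "0 \<notin> S"
      using that by (force simp: P_def cip_def)
    ultimately have "independent S"
      by (rule pairwise_orthogonal_independent)
    then show ?thesis
      using independent_bound by force
  qed
  have "P {}" by (simp add: P_def)
  then obtain S where S: "P S" and max: "\<And>T. P T \<Longrightarrow> card T \<le> card S"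
    using ex_has_greatest_nat[of P "{}" card] bound by blast
  have fin: "finite S" and on: "\<And>s t. s \<in> S \<Longrightarrow> t \<in> S \<Longrightarrow> cip s t = (if s = t then 1 else 0)"
    using S by (auto simp: P_def)
  obtain \<mu> where \<mu>: "\<And>s. s \<in> S \<Longrightarrow> A *v s = complex_of_real (\<mu> s) *s s"
    using S unfolding P_def by metis
  define V where "V = {v. \<forall>s\<in>S. cip s v = 0}"
  have V0: "v = 0" if v: "v \<in> V" for v
  proof (rule ccontr)
    assume "v \<noteq> 0"
    have "subspace V"
      by (auto simp: V_def subspace_def cip_add_right cip_scale_right scaleR_eq_vector_scalar)
        (simp add: cip_def)
    have sa: "inner x (A *v y) = inner (A *v x) y" for x y
      by (simp add: inner_matrix_vector A)
    obtain w m where w: "w \<in> V" "norm w = 1"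
      and "\<And>x. x \<in> V \<Longrightarrow> inner x (A *v x) \<le> m * inner x x"
      and stat: "\<And>x. x \<in> V \<Longrightarrow> inner x (A *v w) = m * inner x w"
      by (rule self_adjoint_max_on_subspace[OF linear_matrix_vector sa \<open>subspace V\<close> v \<open>v \<noteq> 0\<close>]) blast
    \<comment> \<open>The complement of eigenvectors is invariant under \<open>A\<close>, so the
      residual lies in \<open>V\<close>; stationarity then makes it orthogonal to itself.\<close>
    define x where "x = A *v w - complex_of_real m *s w"
    have "x \<in> V"
      using w \<mu> by (auto simp: V_def x_def cip_diff_right cip_matrix_vector A cip_scale_left
          cip_scale_right)
    then have "inner x x = 0"
      using stat[of x] by (simp add: x_def inner_diff_right scaleR_eq_vector_scalar[symmetric])
    then have x: "A *v w = complex_of_real m *s w"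
      by (simp add: x_def)
    have sw: "cip s w = 0" "cip w s = 0" if "s \<in> S" for s
      using w that cip_commute[of w s] by (auto simp: V_def)
    have ww: "cip w w = 1"
      using w by (simp add: cip_self)
    then have "w \<notin> S"
      using sw by auto
    moreover have "P (insert w S)"
      using S sw ww x by (auto simp: P_def)
    ultimately show False
      using max[of "insert w S"] fin by auto
  qed
  have "(\<Sum>s\<in>S. cip s v *s s) = v" for v
  proof -
    have "v - (\<Sum>s\<in>S. cip s v *s s) \<in> V"
      using fin on by (auto simp: V_def cip_diff_right cip_sum_right cip_scale_right
          if_distrib[of "\<lambda>z. _ * z"] sum.delta cong: if_cong)
    from V0[OF this] show ?thesis by simp
  qed
  then have "complex_onb S"
    using fin on by (simp add: complex_onb_def)
  then show thesis using \<mu> that by blast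
qed

text \<open>Functional calculus in the basis \<open>S\<close>: the sum of g(s) |s><s|. Square roots
  and absolute values arise by changing \<open>g\<close>.\<close>

definition spec_mat :: "(complex^'i) set \<Rightarrow> (complex^'i \<Rightarrow> real) \<Rightarrow> complex^'i^'i" where
  "spec_mat S g = (\<chi> i j. \<Sum>s\<in>S. complex_of_real (g s) * s $ i * cnj (s $ j))"

lemma spec_mat_vec: "spec_mat S g *v v = (\<Sum>s\<in>S. (of_real (g s) * cip s v) *s s)"
proof -
  have "(\<Sum>j\<in>UNIV. (\<Sum>s\<in>S. complex_of_real (g s) * s $ i * cnj (s $ j)) * v $ j)
      = (\<Sum>s\<in>S. complex_of_real (g s) * (\<Sum>j\<in>UNIV. cnj (s $ j) * v $ j) * s $ i)" for i
    by (simp add: sum_distrib_left sum_distrib_right, subst sum.swap, simp add: algebra_simps)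
  then show ?thesis
    by (simp add: spec_mat_def matrix_vector_mult_def vec_eq_iff cip_def)
qed

lemma cip_complex_onb_sum:
  assumes "complex_onb S" "s \<in> S"
  shows "cip s (\<Sum>t\<in>S. c t *s t) = c s"
  using assms by (auto simp: complex_onb_def cip_sum_right cip_scale_right
          if_distrib[of "\<lambda>z. _ * z"] sum.delta cong: if_cong)

lemma spec_mat_eigen:
  assumes "complex_onb S" "s \<in> S"
  shows "spec_mat S g *v s = of_real (g s) *s s"
  using assms by (auto simp: spec_mat_vec complex_onb_def if_distrib[of "\<lambda>z. _ * z"]
      if_distrib[of "\<lambda>z. z *s _"] sum.delta cong: if_cong)

lemma spec_mat_mult:
  assumes "complex_onb S"
  shows "spec_mat S g ** spec_mat S h = spec_mat S (\<lambda>s. g s * h s)"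
  unfolding matrix_eq
proof
  fix v
  show "(spec_mat S g ** spec_mat S h) *v v = spec_mat S (\<lambda>s. g s * h s) *v v"
    by (simp add: matrix_vector_mul_assoc[symmetric] spec_mat_vec[of S h] spec_mat_vec[of S g]
        spec_mat_vec[of S "\<lambda>s. g s * h s"] cip_complex_onb_sum[OF assms] mult.assoc)
qed

lemma hermitian_eq_spec_mat:
  assumes S: "complex_onb S" and A: "\<And>s. s \<in> S \<Longrightarrow> A *v s = complex_of_real (\<mu> s) *s s"
  shows "A = spec_mat S \<mu>"
  unfolding matrix_eq
proof
  fix v
  interpret linear "\<lambda>v. A *v v" by (rule linear_matrix_vector)
  have "A *v v = A *v (\<Sum>s\<in>S. cip s v *s s)"
    using S by (simp add: complex_onb_def)
  also have "\<dots> = (\<Sum>s\<in>S. cip s v *s (A *v s))"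
    by (simp add: sum vector_scalar_commute)
  also have "\<dots> = spec_mat S \<mu> *v v"
    by (simp add: spec_mat_vec A vector_smult_assoc mult.commute cong: sum.cong)
  finally show "A *v v = spec_mat S \<mu> *v v" .
qed

lemma dagger_spec_mat: "dagger (spec_mat S g) = spec_mat S g"
  by (simp add: dagger_def spec_mat_def vec_eq_iff algebra_simps)

lemma psd_spec_mat:
  assumes "\<And>s. s \<in> S \<Longrightarrow> 0 \<le> g s"
  shows "psd (spec_mat S g)"
proof -
  have "0 \<le> inner v (spec_mat S g *v v)" for v
  proof -
    have "cip v (spec_mat S g *v v) = (\<Sum>s\<in>S. of_real (g s * (cmod (cip s v))\<^sup>2))"
      by (simp add: spec_mat_vec cip_sum_right cip_scale_right complex_norm_square
          cip_commute[of _ v] mult_ac del: of_real_power)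
    then show ?thesis
      using assms by (simp add: inner_eq_Re_cip sum_nonneg)
  qed
  then show ?thesis by (simp add: psd_iff dagger_spec_mat)
qed

lemma complex_onb_resolution:
  assumes "complex_onb S"
  shows "(\<Sum>s\<in>S. s $ i * cnj (s $ j)) = (if i = j then 1 else 0)"
proof -
  have "cip s (axis j 1) = cnj (s $ j)" for s :: "complex^'a"
    by (simp add: cip_def axis_def if_distrib[of "\<lambda>z. _ * z"] cong: if_cong)
  moreover have "(\<Sum>s\<in>S. cip s (axis j 1) *s s) = axis j 1"
    using assms by (simp add: complex_onb_def)
  ultimately have "(\<Sum>s\<in>S. cnj (s $ j) *s s) = axis j 1" by simp
  then have "(\<Sum>s\<in>S. cnj (s $ j) *s s) $ i = axis j 1 $ i" by simp
  then show ?thesis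
    by (simp add: axis_def mult.commute eq_commute)
qed

lemma trace_eq_sum_complex_onb:
  assumes "complex_onb S"
  shows "trace A = (\<Sum>s\<in>S. cip s (A *v s))"
proof -
  have "(\<Sum>s\<in>S. cip s (A *v s)) = (\<Sum>s\<in>S. \<Sum>i\<in>UNIV. \<Sum>j\<in>UNIV. A $ i $ j * (s $ j * cnj (s $ i)))"
    by (simp add: cip_def matrix_vector_mult_def sum_distrib_left algebra_simps)
  also have "\<dots> = (\<Sum>i\<in>UNIV. \<Sum>j\<in>UNIV. A $ i $ j * (\<Sum>s\<in>S. s $ j * cnj (s $ i)))"
    by (subst sum.swap, rule sum.cong[OF refl], subst sum.swap) (simp add: sum_distrib_left)
  also have "\<dots> = trace A"
    by (simp add: complex_onb_resolution[OF assms] trace_def if_distrib[of "\<lambda>z. _ * z"] cong: if_cong)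
  finally show ?thesis ..
qed

lemma hermitian_real_eigenvalues_zero:
  assumes "dagger A = A" and "\<And>v \<mu>. A *v v = complex_of_real \<mu> *s v \<Longrightarrow> norm v = 1 \<Longrightarrow> \<mu> = 0"
  shows "A = 0"
proof -
  obtain S \<mu> where S: "complex_onb S" "\<And>s. s \<in> S \<Longrightarrow> A *v s = complex_of_real (\<mu> s) *s s"
    using hermitian_spectral[OF assms(1)] by metis
  have "norm s = 1" if "s \<in> S" for s
  proof -
    have "cip s s = 1" using S(1) that by (simp add: complex_onb_def)
    then have "(norm s)\<^sup>2 = 1" by (metis cip_self of_real_eq_1_iff)
    then show ?thesis by (simp add: abs_square_eq_1)
  qed
  then have "\<mu> s = 0" if "s \<in> S" for s
    using assms(2) S(2) that by blast
  then show ?thesis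
    using hermitian_eq_spec_mat[OF S] by (simp add: spec_mat_def vec_eq_iff)
qed

lemma dagger_diff: "dagger (A - B) = dagger A - dagger B"
  by (simp add: dagger_def vec_eq_iff)

lemma dagger_mult: "dagger (A ** B) = dagger B ** dagger A"
  by (simp add: dagger_def matrix_matrix_mult_def vec_eq_iff mult.commute)

lemma dagger_dagger [simp]: "dagger (dagger A) = A"
  by (simp add: dagger_def vec_eq_iff)

section \<open>Positive square roots and the trace norm\<close>

text \<open>Let v be a unit eigenvector of B - C with eigenvalue \<mu>. Equality of the squares
  gives |Bv| = |Cv|, hence \<mu> (<v,Bv> + <v,Cv>) = 0. If \<mu> were nonzero, both nonnegative
  forms would vanish, yet they differ by \<mu>. So the description in \<open>psd_sqrt\<close> has at
  most one solution.\<close>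

lemma psd_square_inj:
  assumes B: "psd B" and C: "psd C" and eq: "B ** B = C ** C"
  shows "B = C"
proof -
  have "B - C = 0"
  proof (rule hermitian_real_eigenvalues_zero)
    show "dagger (B - C) = B - C"
      using B C by (simp add: psd_def dagger_diff)
    fix v \<mu>
    assume v: "(B - C) *v v = complex_of_real \<mu> *s v" "norm v = 1"
    then have Bv: "B *v v = C *v v + \<mu> *\<^sub>R v"
      by (simp add: matrix_vector_mult_diff_rdistrib scaleR_eq_vector_scalar algebra_simps)
    then have d: "B *v v - C *v v = \<mu> *\<^sub>R v" by simp
    have "inner v (B *v (B *v v)) = inner v (C *v (C *v v))"
      using eq by (simp add: matrix_vector_mul_assoc)
    moreover have "inner v (B *v (B *v v)) = inner (B *v v) (B *v v)"
      using B by (metis inner_matrix_vector psd_def)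
    moreover have "inner v (C *v (C *v v)) = inner (C *v v) (C *v v)"
      using C by (metis inner_matrix_vector psd_def)
    ultimately have "inner (B *v v - C *v v) (B *v v + C *v v) = 0"
      by (simp add: inner_diff_left inner_diff_right inner_add_right inner_commute)
    then have "\<mu> * (inner v (B *v v) + inner v (C *v v)) = 0"
      using d by (simp only: inner_scaleR_left inner_add_right distrib_left)
    moreover have "0 \<le> inner v (B *v v)" "0 \<le> inner v (C *v v)"
      using B C by (auto simp: psd_iff)
    moreover have "inner v (B *v v) = inner v (C *v v) + \<mu>"
      using Bv v(2) by (simp add: inner_add_right dot_square_norm)
    ultimately show "\<mu> = 0"
      by (smt (verit) mult_eq_0_iff)
  qed
  then show ?thesis by simp
qed

lemma psd_sqrt_eqI:
  assumes "psd B" "B ** B = A"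
  shows "psd_sqrt A = B"
  unfolding psd_sqrt_def using assms by (auto intro: the_equality psd_square_inj)

lemma psd_eigenvalue_nonneg:
  assumes "psd A" "A *v s = complex_of_real m *s s" "cip s s = 1"
  shows "0 \<le> m"
proof -
  have "inner s (A *v s) = m"
    using assms by (simp add: inner_eq_Re_cip cip_scale_right)
  then show ?thesis using assms(1) by (metis psd_iff)
qed

lemma psd_sqrt_properties:
  assumes "psd A"
  shows "psd (psd_sqrt A)" "psd_sqrt A ** psd_sqrt A = A"
proof -
  obtain S \<mu> where S: "complex_onb S" "\<And>s. s \<in> S \<Longrightarrow> A *v s = complex_of_real (\<mu> s) *s s"
    using assms hermitian_spectral[of A] by (metis psd_def)
  have pos: "0 \<le> \<mu> s" if "s \<in> S" for s
    using psd_eigenvalue_nonneg[OF assms S(2)] that S(1) by (simp add: complex_onb_def)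
  let ?B = "spec_mat S (\<lambda>s. sqrt (\<mu> s))"
  have "psd ?B"
    by (intro psd_spec_mat) (simp add: pos)
  moreover have "?B ** ?B = A"
  proof -
    have "spec_mat S (\<lambda>s. sqrt (\<mu> s) * sqrt (\<mu> s)) = spec_mat S \<mu>"
      using pos by (simp add: spec_mat_def)
    then show ?thesis
      using hermitian_eq_spec_mat[OF S, symmetric] by (simp only: spec_mat_mult[OF S(1)])
  qed
  ultimately show "psd (psd_sqrt A)" "psd_sqrt A ** psd_sqrt A = A"
    using psd_sqrt_eqI by metis+
qed

lemma psd_dagger_mult: "psd (dagger A ** A)"
  by (simp add: psd_iff dagger_mult matrix_vector_mul_assoc[symmetric]
      inner_matrix_vector[of _ "dagger A"])

lemma psd_trace_nonneg:
  assumes "psd A"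
  shows "0 \<le> Re (trace A)"
proof -
  obtain S \<mu> where S: "complex_onb S" "\<And>s. s \<in> S \<Longrightarrow> A *v s = complex_of_real (\<mu> s) *s s"
    using assms hermitian_spectral[of A] by (metis psd_def)
  have "Re (trace A) = (\<Sum>s\<in>S. inner s (A *v s))"
    by (simp add: trace_eq_sum_complex_onb[OF S(1)] inner_eq_Re_cip)
  then show ?thesis
    using assms by (simp add: sum_nonneg psd_iff)
qed

lemma trace_norm_nonneg: "0 \<le> trace_norm A"
  unfolding trace_norm_def by (intro psd_trace_nonneg psd_sqrt_properties psd_dagger_mult)

text \<open>In an eigenbasis of P - Q the trace norm is the sum of the |\<mu>(s)|. Each \<mu>(s) is
  a difference of two nonnegative diagonal entries, so its modulus is at most their sum, and these
  sums add up to the two traces.\<close>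

lemma trace_norm_diff_psd_le:
  assumes P: "psd P" and Q: "psd Q"
  shows "trace_norm (P - Q) \<le> Re (trace P) + Re (trace Q)"
proof -
  let ?X = "P - Q"
  have X: "dagger ?X = ?X"
    using P Q by (simp add: psd_def dagger_diff)
  obtain S \<mu> where S: "complex_onb S" and \<mu>: "\<And>s. s \<in> S \<Longrightarrow> ?X *v s = complex_of_real (\<mu> s) *s s"
    using hermitian_spectral[OF X] by metis
  have Xs: "?X = spec_mat S \<mu>"
    using S \<mu> by (rule hermitian_eq_spec_mat)
  let ?B = "spec_mat S (\<lambda>s. \<bar>\<mu> s\<bar>)"
  have "psd_sqrt (dagger ?X ** ?X) = ?B"
    by (rule psd_sqrt_eqI) (simp_all only: Xs dagger_spec_mat spec_mat_mult[OF S]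
        abs_mult_self_eq psd_spec_mat abs_ge_zero)
  then have "trace_norm ?X = (\<Sum>s\<in>S. \<bar>\<mu> s\<bar>)"
    using S by (simp add: trace_norm_def trace_eq_sum_complex_onb[OF S] spec_mat_eigen[OF S]
        cip_scale_right complex_onb_def cong: sum.cong)
  also have "\<dots> \<le> (\<Sum>s\<in>S. inner s (P *v s) + inner s (Q *v s))"
  proof (rule sum_mono)
    fix s assume s: "s \<in> S"
    have "\<mu> s = inner s (?X *v s)"
      using S s \<mu>[OF s] by (simp add: inner_eq_Re_cip cip_scale_right complex_onb_def)
    also have "\<dots> = inner s (P *v s) - inner s (Q *v s)"
      by (simp add: matrix_vector_mult_diff_rdistrib inner_diff_right)
    finally show "\<bar>\<mu> s\<bar> \<le> inner s (P *v s) + inner s (Q *v s)"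
      using P Q unfolding psd_iff by (smt (verit))
  qed
  also have "\<dots> = Re (trace P) + Re (trace Q)"
    by (simp add: trace_eq_sum_complex_onb[OF S] inner_eq_Re_cip sum.distrib)
  finally show ?thesis .
qed

section \<open>Symmetric tensors and product vectors\<close>

text \<open>Polarisation at unit vectors combined with the parallelogram law, which together lose no
  constant: a bound on the quadratic form passes unchanged to the bilinear form.\<close>

lemma symmetric_bilinear_bound:
  fixes \<beta> :: "'a::real_inner \<Rightarrow> 'a \<Rightarrow> real"
  assumes bil: "bilinear \<beta>" and sym: "\<And>v w. \<beta> v w = \<beta> w v"
    and bound: "\<And>v. \<bar>\<beta> v v\<bar> \<le> c * (norm v)\<^sup>2"
  shows "\<bar>\<beta> v w\<bar> \<le> c * norm v * norm w"
proof (cases "v = 0 \<or> w = 0")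
  case True
  then show ?thesis
    using bil by (auto simp: bilinear_lzero bilinear_rzero)
next
  case False
  define v' where "v' = v /\<^sub>R norm v"
  define w' where "w' = w /\<^sub>R norm w"
  have unit: "norm v' = 1" "norm w' = 1"
    using False by (auto simp: v'_def w'_def)
  have "4 * \<beta> v' w' = \<beta> (v' + w') (v' + w') - \<beta> (v' - w') (v' - w')"
    using bil sym[of w' v'] by (simp add: bilinear_ladd bilinear_radd bilinear_lsub bilinear_rsub)
  also have "\<bar>\<dots>\<bar> \<le> c * (norm (v' + w'))\<^sup>2 + c * (norm (v' - w'))\<^sup>2"
    using bound[of "v' + w'"] bound[of "v' - w'"] by linarith
  also have "\<dots> = c * ((norm (v' + w'))\<^sup>2 + (norm (v' - w'))\<^sup>2)"
    by (simp add: algebra_simps)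
  also have "(norm (v' + w'))\<^sup>2 + (norm (v' - w'))\<^sup>2 = 4"
    using unit by (simp add: power2_norm_eq_inner inner_add_left inner_add_right inner_diff_left
        inner_diff_right norm_eq_1)
  finally have "\<bar>\<beta> v' w'\<bar> \<le> c" by simp
  moreover have "\<beta> v w = norm v * norm w * \<beta> v' w'"
    using bil False by (simp add: v'_def w'_def bilinear_lmul bilinear_rmul field_simps)
  ultimately show ?thesis
    using mult_left_mono[of "\<bar>\<beta> v' w'\<bar>" c "norm v * norm w"]
    by (simp add: abs_mult mult_ac)
qed

text \<open>The bilinear bound is tested on the pair \<open>G *v w\<close>,
  \<open>w\<close>.\<close>

lemma hermitian_norm_bound:
  fixes G :: "complex^'i^'i"
  assumes G: "dagger G = G" and bound: "\<And>v. \<bar>inner v (G *v v)\<bar> \<le> c * (norm v)\<^sup>2"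
  shows "norm (G *v w) \<le> c * norm w"
proof -
  have "bilinear (\<lambda>v w. inner v (G *v w))"
    unfolding bilinear_def
    by (auto intro!: linearI simp: inner_add_left inner_add_right linear_add[OF linear_matrix_vector]
        linear_scale[OF linear_matrix_vector])
  moreover have "inner v (G *v w) = inner w (G *v v)" for v w
    by (subst inner_matrix_vector) (simp add: G inner_commute)
  ultimately have "\<bar>inner (G *v w) (G *v w)\<bar> \<le> c * norm (G *v w) * norm w"
    by (rule symmetric_bilinear_bound) (rule bound)
  then have "norm (G *v w) * norm (G *v w) \<le> norm (G *v w) * (c * norm w)"
    by (simp add: dot_square_norm power2_eq_square mult_ac)
  moreover have "0 \<le> c * norm w"
    using order_trans[OF abs_ge_zero bound[of w]] by (cases "w = 0") (auto simp: zero_le_mult_iff)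
  ultimately show ?thesis
    by (cases "G *v w = 0") auto
qed

text \<open>Divide by |t| for both signs of t, then, once the linear coefficient is gone, by t^2,
  and let t tend to 0. The limit is taken by \<open>aux\<close>: a number below h k for all small
  positive h cannot be positive.\<close>

lemma second_order_sign:
  fixes x1 x2 R \<delta> :: real
  assumes \<delta>: "0 < \<delta>"
    and le: "\<And>t. \<bar>t\<bar> \<le> \<delta> \<Longrightarrow> x1 * t + x2 * t\<^sup>2 \<le> R * \<bar>t\<bar> ^ 3"
  shows "x1 = 0" "x2 \<le> 0"
proof -
  have aux: "y \<le> 0" if y: "\<And>h. 0 < h \<Longrightarrow> h \<le> \<delta> \<Longrightarrow> y \<le> h * k" for y k
  proof (rule ccontr)
    assume "\<not> y \<le> 0"
    define h where "h = min \<delta> (y / (2 * (\<bar>k\<bar> + 1)))"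
    have h: "0 < h" "h \<le> \<delta>" "h \<le> y / (2 * (\<bar>k\<bar> + 1))"
      using \<open>\<not> y \<le> 0\<close> \<delta> by (auto simp: h_def)
    have "y \<le> h * k" using y h by blast
    also have "\<dots> \<le> h * (\<bar>k\<bar> + 1)"
      using h by (intro mult_left_mono) auto
    also have "\<dots> \<le> y / (2 * (\<bar>k\<bar> + 1)) * (\<bar>k\<bar> + 1)"
      using h by (intro mult_right_mono) auto
    also have "\<dots> = y / 2"
      by (simp add: field_simps)
    finally show False using \<open>\<not> y \<le> 0\<close> by simp
  qed
  have "s * x1 \<le> 0" if s: "s = 1 \<or> s = -1" for s
  proof (rule aux)
    fix h :: real assume h: "0 < h" "h \<le> \<delta>"
    have "x1 * (s * h) + x2 * (s * h)\<^sup>2 \<le> R * \<bar>s * h\<bar> ^ 3"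
      using h s by (intro le) auto
    then have "h * (s * x1) \<le> h * (R * h\<^sup>2 - x2 * h)"
      using h s by (auto simp: power3_eq_cube power2_eq_square algebra_simps)
    then have "s * x1 \<le> R * h\<^sup>2 - x2 * h"
      using h by (simp add: mult_le_cancel_left_pos)
    also have "\<dots> = h * (R * h - x2)"
      by (simp add: power2_eq_square algebra_simps)
    also have "R * h \<le> \<bar>R\<bar> * \<delta>"
      using h by (meson abs_ge_self abs_ge_zero less_imp_le mult_mono order_trans)
    finally show "s * x1 \<le> h * (\<bar>R\<bar> * \<delta> - x2)"
      using h by (simp add: mult_left_mono)
  qed
  from this[of 1] this[of "-1"] show x1: "x1 = 0" by simp
  show "x2 \<le> 0"
  proof (rule aux)
    fix h :: real assume h: "0 < h" "h \<le> \<delta>"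
    have "h\<^sup>2 * x2 \<le> h\<^sup>2 * (h * R)"
      using le[of h] h x1 by (simp add: power3_eq_cube power2_eq_square mult_ac)
    then show "x2 \<le> h * R"
      using h by (simp add: mult_le_cancel_left_pos)
  qed
qed

section \<open>Pairings of symmetric tensors with product vectors\<close>

text \<open>\<open>pairing \<Psi> g\<close> is \<open>\<langle>\<Psi>, \<otimes>\<^sub>k g k\<rangle>\<close>.\<close>

definition pairing :: "complex^('n::finite \<Rightarrow> 'D::finite) \<Rightarrow> ('n \<Rightarrow> complex^'D) \<Rightarrow> complex" where
  "pairing \<Psi> g = (\<Sum>x\<in>UNIV. cnj (\<Psi> $ x) * (\<Prod>k\<in>UNIV. g k $ x k))"

definition sym_tensor :: "complex^('n::finite \<Rightarrow> 'D::finite) \<Rightarrow> bool" where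
  "sym_tensor \<Psi> \<longleftrightarrow> (\<forall>\<pi>. bij \<pi> \<longrightarrow> (\<forall>x. \<Psi> $ (x \<circ> \<pi>) = \<Psi> $ x))"

lemma pairing_permute:
  assumes \<Psi>: "sym_tensor \<Psi>" and \<pi>: "bij \<pi>"
  shows "pairing \<Psi> (g \<circ> \<pi>) = pairing \<Psi> g"
proof -
  have inv: "inv \<pi> \<circ> \<pi> = id" "\<pi> \<circ> inv \<pi> = id"
    using \<pi> by (auto simp: bij_def surj_iff)
  have "pairing \<Psi> g = (\<Sum>x\<in>UNIV. cnj (\<Psi> $ (x \<circ> inv \<pi>)) * (\<Prod>k\<in>UNIV. g k $ (x \<circ> inv \<pi>) k))"
    unfolding pairing_def
    by (rule sum.reindex_bij_witness[of _ "\<lambda>x. x \<circ> inv \<pi>" "\<lambda>x. x \<circ> \<pi>"])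
      (simp_all add: comp_assoc inv)
  also have "\<dots> = (\<Sum>x\<in>UNIV. cnj (\<Psi> $ x) * (\<Prod>k\<in>UNIV. (g \<circ> \<pi>) k $ x k))"
  proof (rule sum.cong[OF refl])
    fix x :: "'a \<Rightarrow> 'b"
    have "(\<Prod>k\<in>UNIV. g k $ (x \<circ> inv \<pi>) k) = (\<Prod>k\<in>UNIV. (g \<circ> \<pi>) k $ x k)"
      using \<pi> by (intro prod.reindex_bij_witness[of _ \<pi> "inv \<pi>"]) (auto simp: bij_def surj_f_inv_f)
    moreover have "\<Psi> $ (x \<circ> inv \<pi>) = \<Psi> $ x"
      using \<Psi> \<pi> bij_imp_bij_inv by (auto simp: sym_tensor_def)
    ultimately show "cnj (\<Psi> $ (x \<circ> inv \<pi>)) * (\<Prod>k\<in>UNIV. g k $ (x \<circ> inv \<pi>) k)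
        = cnj (\<Psi> $ x) * (\<Prod>k\<in>UNIV. (g \<circ> \<pi>) k $ x k)" by simp
  qed
  finally show ?thesis by (simp add: pairing_def)
qed

lemma pairing_fun_upd:
  "pairing \<Psi> (g(a := v)) = (\<Sum>x\<in>UNIV. cnj (\<Psi> $ x) * (v $ x a * (\<Prod>k\<in>UNIV - {a}. g k $ x k)))"
proof -
  have "(\<Prod>k\<in>UNIV. (g(a := v)) k $ x k) = v $ x a * (\<Prod>k\<in>UNIV - {a}. g k $ x k)" for x
    by (subst prod.remove[of _ a]) auto
  then show ?thesis by (simp add: pairing_def)
qed

lemma pairing_add: "pairing \<Psi> (g(a := v + w)) = pairing \<Psi> (g(a := v)) + pairing \<Psi> (g(a := w))"
  and pairing_scale: "pairing \<Psi> (g(a := c *s v)) = c * pairing \<Psi> (g(a := v))"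
  by (simp_all add: pairing_fun_upd algebra_simps sum.distrib sum_distrib_left)

lemma pairing_power_scale:
  "pairing \<Psi> (\<lambda>_. c *s v) = c ^ CARD('n) * pairing (\<Psi> :: complex^('n::finite \<Rightarrow> 'D::finite)) (\<lambda>_. v)"
  by (simp add: pairing_def prod.distrib sum_distrib_left mult_ac)

lemma pairing_axes:
  "pairing \<Psi> (\<lambda>k. axis (y k) 1) = cnj (\<Psi> $ y)"
proof -
  have "(\<Prod>k\<in>UNIV. axis (y k) (1::complex) $ x k) = (if x = y then 1 else 0)" for x
  proof (cases "x = y")
    case False
    then obtain k where "x k \<noteq> y k" by auto
    then have "axis (y k) (1::complex) $ x k = 0" by (simp add: axis_def)
    then show ?thesis using False by (auto intro!: prod_zero)
  qed (simp add: axis_def)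
  then show ?thesis
    by (simp add: pairing_def if_distrib[of "\<lambda>z. _ * z"] cong: if_cong)
qed

lemma pairing_sum:
  fixes T :: "'k set" and G :: "'k \<Rightarrow> complex^'D::finite"
    and \<Psi> :: "complex^('n::finite \<Rightarrow> 'D)"
  assumes "finite T"
  shows "pairing \<Psi> (\<lambda>_. \<Sum>k\<in>T. G k) = (\<Sum>g\<in>UNIV \<rightarrow> T. pairing \<Psi> (\<lambda>j. G (g j)))"
proof -
  have "(\<Prod>j\<in>UNIV. \<Sum>k\<in>T. G k $ x j) = (\<Sum>g\<in>UNIV \<rightarrow> T. \<Prod>j\<in>UNIV. G (g j) $ x j)"
    for x :: "'n \<Rightarrow> 'D"
    using prod_sum_PiE[of UNIV "\<lambda>_. T" "\<lambda>j k. G k $ x j"] assms by (simp add: PiE_UNIV_domain)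
  then show ?thesis
    by (simp add: pairing_def sum_distrib_left) (rule sum.swap)
qed

text \<open>Inserting or removing a fixed element outside \<open>R\<close> is an involution on the
  supersets of \<open>R\<close> that flips the sign.\<close>

lemma alternating_sum_supersets:
  fixes R :: "'a::finite set"
  assumes "R \<noteq> UNIV"
  shows "(\<Sum>T | R \<subseteq> T. (-1) ^ card T) = (0::complex)"
proof -
  obtain k where k: "k \<notin> R" using assms by auto
  define flip where "flip T = (if k \<in> T then T - {k} else insert k T)" for T
  have card: "(-1) ^ card (flip T) = - ((-1) ^ card T :: complex)" for T
  proof (cases "k \<in> T")
    case True
    then have "card T = Suc (card (flip T))"
      using card.remove[of T k] by (simp add: flip_def)
    then show ?thesis by simp
  qed (simp add: flip_def)
  have flip_flip: "flip (flip T) = T" for T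
    by (auto simp: flip_def)
  have flip_sup: "x \<in> flip T" if "R \<subseteq> T" "x \<in> R" for T x
    using that k by (auto simp: flip_def)
  have "(\<Sum>T | R \<subseteq> T. (-1) ^ card T) = (\<Sum>T | R \<subseteq> T. (-1) ^ card (flip T) :: complex)"
    by (rule sum.reindex_bij_witness[of _ flip flip]) (auto simp: flip_flip flip_sup)
  also have "\<dots> = - (\<Sum>T | R \<subseteq> T. (-1) ^ card T)"
    by (simp add: card sum_negf)
  finally show ?thesis by simp
qed

lemma sym_tensor_polarization:
  fixes \<Psi> :: "complex^('n::finite \<Rightarrow> 'D::finite)"
  assumes \<Psi>: "sym_tensor \<Psi>" and zero: "\<And>w. pairing \<Psi> (\<lambda>_. w) = 0"
  shows "\<Psi> = 0"
proof -
  \<comment> \<open>Inclusion-exclusion over sets \<open>T\<close> of positions of \<open>x\<close>: in the alternating sum only the bijective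
    reindexings of \<open>x\<close> survive.\<close>
  have "\<Psi> $ x = 0" for x
  proof -
    have "0 = (\<Sum>T\<in>UNIV. (-1) ^ card T * pairing \<Psi> (\<lambda>_. \<Sum>k\<in>(T :: 'n set). axis (x k) 1))"
      by (simp add: zero)
    also have "\<dots> = (\<Sum>T\<in>UNIV. (-1) ^ card T * (\<Sum>g | range g \<subseteq> T. cnj (\<Psi> $ (x \<circ> g))))"
      by (simp add: pairing_sum pairing_axes comp_def Pi_def image_subset_iff)
    also have "\<dots> = (\<Sum>T\<in>UNIV. \<Sum>g\<in>UNIV. if range g \<subseteq> T then (-1) ^ card T * cnj (\<Psi> $ (x \<circ> g)) else 0)"
      by (simp add: sum_distrib_left sum.If_cases)
    also have "\<dots> = (\<Sum>g\<in>UNIV. \<Sum>T\<in>UNIV. if range g \<subseteq> T then (-1) ^ card T * cnj (\<Psi> $ (x \<circ> g)) else 0)"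
      by (rule sum.swap)
    also have "\<dots> = (\<Sum>g\<in>UNIV. (\<Sum>T | range g \<subseteq> T. (-1) ^ card T) * cnj (\<Psi> $ (x \<circ> g)))"
      by (simp add: sum_distrib_right sum.If_cases)
    also have "\<dots> = (\<Sum>g :: 'n \<Rightarrow> 'n \<in>UNIV. if bij g then (-1) ^ CARD('n) * cnj (\<Psi> $ x) else 0)"
    proof (rule sum.cong[OF refl])
      fix g :: "'n \<Rightarrow> 'n"
      show "(\<Sum>T | range g \<subseteq> T. (-1) ^ card T) * cnj (\<Psi> $ (x \<circ> g))
          = (if bij g then (-1) ^ CARD('n) * cnj (\<Psi> $ x) else 0)"
      proof (cases "bij g")
        case True
        then have "{T. range g \<subseteq> T} = {UNIV}" by (auto simp: bij_def)
        then show ?thesis using True \<Psi> by (simp add: sym_tensor_def)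
      next
        case False
        then have "range g \<noteq> UNIV" by (auto simp: bij_def finite_UNIV_surj_inj)
        then show ?thesis using False alternating_sum_supersets[of "range g"] by simp
      qed
    qed
    also have "\<dots> = of_nat (card {g :: 'n \<Rightarrow> 'n. bij g}) * ((-1) ^ CARD('n) * cnj (\<Psi> $ x))"
      by (simp add: sum.If_cases)
    finally have "card {g :: 'n \<Rightarrow> 'n. bij g} = 0 \<or> \<Psi> $ x = 0" by auto
    moreover have "id \<in> {g :: 'n \<Rightarrow> 'n. bij g}" by simp
    then have "card {g :: 'n \<Rightarrow> 'n. bij g} \<noteq> 0" by (metis card_0_eq empty_iff finite)
    ultimately show ?thesis by simp
  qed
  then show ?thesis by (simp add: vec_eq_iff)
qed

text \<open>A maximiser on the unit sphere. Homogeneity of degree N extends the inequality to all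
  \<open>w\<close>, so that it applies to perturbations of \<open>u\<close> without renormalising
  them. By \<open>sym_tensor_polarization\<close> the maximum is not zero, which later permits
  division by it.\<close>

lemma exists_nearest_product:
  fixes \<Psi> :: "complex^('n::finite \<Rightarrow> 'D::finite)"
  assumes \<Psi>: "sym_tensor \<Psi>" "\<Psi> \<noteq> 0"
  obtains u where "norm u = 1" "pairing \<Psi> (\<lambda>_. u) \<noteq> 0"
    "\<And>w. cmod (pairing \<Psi> (\<lambda>_. w)) \<le> cmod (pairing \<Psi> (\<lambda>_. u)) * norm w ^ CARD('n)"
proof -
  let ?f = "\<lambda>w. cmod (pairing \<Psi> (\<lambda>_. w))"
  have "continuous_on (sphere 0 1) ?f"
    unfolding pairing_def by (intro continuous_intros)
  moreover have "axis undefined 1 \<in> sphere (0 :: complex^'D) 1"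
    by simp
  ultimately obtain u where u: "norm u = 1" and max: "\<And>w. norm w = 1 \<Longrightarrow> ?f w \<le> ?f u"
    using continuous_attains_sup[of "sphere 0 1" ?f] by auto
  have le: "?f w \<le> ?f u * norm w ^ CARD('n)" for w
  proof (cases "w = 0")
    case True
    then have "w = 0 *s w" by simp
    then have "pairing \<Psi> (\<lambda>_. w) = 0"
      using pairing_power_scale[of \<Psi> 0 w] by (simp add: zero_power)
    then show ?thesis by simp
  next
    case False
    define w' where "w' = complex_of_real (1 / norm w) *s w"
    have "norm w' = 1"
      using False by (simp add: w'_def norm_vector_scalar norm_divide)
    moreover have "w = complex_of_real (norm w) *s w'"
      using False by (simp add: w'_def)
    then have "?f w = norm w ^ CARD('n) * ?f w'"
      using pairing_power_scale[of \<Psi> "complex_of_real (norm w)" w'] by (simp add: norm_mult norm_power)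
    ultimately show ?thesis
      using max[of w'] by (simp add: mult_left_mono mult.commute)
  qed
  have "pairing \<Psi> (\<lambda>_. u) \<noteq> 0"
  proof
    assume "pairing \<Psi> (\<lambda>_. u) = 0"
    then have "pairing \<Psi> (\<lambda>_. w) = 0" for w
      using le[of w] by simp
    then show False
      using sym_tensor_polarization \<Psi> by blast
  qed
  then show thesis
    using that u le by blast
qed

section \<open>Optimality conditions at the nearest product vector\<close>

abbreviation mixed :: "'n set \<Rightarrow> 'v \<Rightarrow> 'v \<Rightarrow> 'n \<Rightarrow> 'v" where
  "mixed S v u k \<equiv> (if k \<in> S then v else u)"

lemma pairing_binomial:
  "pairing \<Psi> (\<lambda>_. u + c *s v) = (\<Sum>S\<in>UNIV. c ^ card S * pairing \<Psi> (mixed S v u))"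
proof -
  have "(\<Prod>k\<in>UNIV. (u + c *s v) $ x k) = (\<Sum>S\<in>UNIV. c ^ card S * (\<Prod>k\<in>UNIV. mixed S v u k $ x k))"
    for x :: "'a \<Rightarrow> 'b"
  proof -
    have "(\<Prod>k\<in>UNIV. (u + c *s v) $ x k) = (\<Prod>k\<in>UNIV. c * v $ x k + u $ x k)"
      by (simp add: add.commute)
    also have "\<dots> = (\<Sum>S\<in>UNIV. (\<Prod>k\<in>S. c * v $ x k) * (\<Prod>k\<in>UNIV - S. u $ x k))"
      by (subst prod_add) simp_all
    also have "\<dots> = (\<Sum>S\<in>UNIV. c ^ card S * (\<Prod>k\<in>UNIV. mixed S v u k $ x k))"
      by (simp add: if_distrib[of "\<lambda>w. w $ _"] prod.If_cases prod.distrib Compl_eq_Diff_UNIV mult.assoc)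
    finally show ?thesis .
  qed
  then show ?thesis
    by (simp add: pairing_def sum_distrib_left, subst sum.swap) (simp add: mult_ac)
qed

text \<open>Some permutation of the positions carries \<open>S\<close> onto \<open>T\<close> and the
  complement of \<open>S\<close> onto that of \<open>T\<close>; the symmetry of \<Psi> absorbs
  it.\<close>

lemma pairing_mixed_card:
  fixes S T :: "'n::finite set"
  assumes \<Psi>: "sym_tensor \<Psi>" and card: "card S = card T"
  shows "pairing \<Psi> (mixed S v u) = pairing \<Psi> (mixed T v u)"
proof -
  obtain f where f: "bij_betw f S T"
    using card by (metis finite finite_same_card_bij)
  have "card (- S) = card (- T)"
    using card by (simp add: Compl_eq_Diff_UNIV card_Diff_subset)
  then obtain g where g: "bij_betw g (- S) (- T)"
    by (metis finite finite_same_card_bij)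
  define \<pi> where "\<pi> k = (if k \<in> S then f k else g k)" for k
  have "bij_betw \<pi> (S \<union> - S) (T \<union> - T)"
    unfolding \<pi>_def by (rule bij_betw_disjoint_Un[OF f g]) auto
  then have "bij \<pi>" by simp
  moreover have "mixed T v u \<circ> \<pi> = mixed S v u"
    using f g by (auto simp: \<pi>_def fun_eq_iff bij_betw_def)
  ultimately show ?thesis
    using pairing_permute[OF \<Psi>, of \<pi> "mixed T v u"] by simp
qed

text \<open>Group the binomial expansion by the number of positions that hold \<open>v\<close>. By
  symmetry \<open>{a}\<close> and \<open>{a, b}\<close> represent all sets of size 1 and 2, which
  explains the coefficients N and N choose 2. Sets of size at least 3 form the cubic
  remainder.\<close>

lemma pairing_second_order_expansion:
  fixes \<Psi> :: "complex^('n::finite \<Rightarrow> 'D::finite)"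
  assumes \<Psi>: "sym_tensor \<Psi>" and ab: "a \<noteq> b"
  obtains R where "\<And>t. \<bar>t\<bar> \<le> 1 \<Longrightarrow>
    cmod (pairing \<Psi> (\<lambda>_. u + complex_of_real t *s v) -
      (pairing \<Psi> (\<lambda>_. u) + of_real (real CARD('n) * t) * pairing \<Psi> ((\<lambda>_. u)(a := v)) +
       of_real (real (CARD('n) choose 2) * t\<^sup>2) * pairing \<Psi> ((\<lambda>_. u)(a := v, b := v)))) \<le> R * \<bar>t\<bar> ^ 3"
proof -
  let ?P = "\<lambda>S. pairing \<Psi> (mixed S v u)"
  have split: "z = (if n = 0 then z else 0) + (if n = 1 then z else 0) +
        (if n = 2 then z else 0) + (if 3 \<le> n then z else 0)" for n :: nat and z :: complex
    by (cases "n = 0"; cases "n = 1"; cases "n = 2") auto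
  have card_sets: "card {S :: 'n set. card S = j} = CARD('n) choose j" for j
    using n_subsets[of "UNIV :: 'n set" j] by simp
  have P1: "?P S = pairing \<Psi> ((\<lambda>_. u)(a := v))" if "card S = 1" for S
  proof -
    have "mixed {a} v u = (\<lambda>_. u)(a := v)" by auto
    then show ?thesis
      using pairing_mixed_card[OF \<Psi>, of S "{a}" v u] that by simp
  qed
  have P2: "?P S = pairing \<Psi> ((\<lambda>_. u)(a := v, b := v))" if "card S = 2" for S
  proof -
    have "mixed {a, b} v u = (\<lambda>_. u)(a := v, b := v)" by auto
    then show ?thesis
      using pairing_mixed_card[OF \<Psi>, of S "{a, b}" v u] that ab by simp
  qed
  define R where "R = (\<Sum>S\<in>UNIV. cmod (?P S))"
  have "cmod (pairing \<Psi> (\<lambda>_. u + complex_of_real t *s v) -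
      (pairing \<Psi> (\<lambda>_. u) + of_real (real CARD('n) * t) * pairing \<Psi> ((\<lambda>_. u)(a := v)) +
       of_real (real (CARD('n) choose 2) * t\<^sup>2) * pairing \<Psi> ((\<lambda>_. u)(a := v, b := v)))) \<le> R * \<bar>t\<bar> ^ 3"
    if t: "\<bar>t\<bar> \<le> 1" for t
  proof -
    let ?F = "\<lambda>S. of_real t ^ card S * ?P S"
    let ?G = "\<lambda>j. \<Sum>S\<in>UNIV. if card S = j then ?F S else 0"
    have "pairing \<Psi> (\<lambda>_. u + complex_of_real t *s v) = (\<Sum>S\<in>UNIV. ?F S)"
      by (rule pairing_binomial)
    also have "\<dots> = (\<Sum>S\<in>UNIV. (if card S = 0 then ?F S else 0) + (if card S = 1 then ?F S else 0) +
        (if card S = 2 then ?F S else 0) + (if 3 \<le> card S then ?F S else 0))"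
      by (intro sum.cong[OF refl] split)
    also have "\<dots> = ?G 0 + ?G 1 + ?G 2 + (\<Sum>S\<in>UNIV. if 3 \<le> card S then ?F S else 0)"
      by (simp add: sum.distrib del: card_0_eq card_eq_0_iff)
    also have "?G 0 = pairing \<Psi> (\<lambda>_. u)"
      by simp
    also have "?G 1 = (\<Sum>S :: 'n set | card S = 1. of_real t * pairing \<Psi> ((\<lambda>_. u)(a := v)))"
      by (subst sum.inter_filter[symmetric]) (auto simp: P1 intro!: sum.cong)
    also have "\<dots> = of_real (real CARD('n) * t) * pairing \<Psi> ((\<lambda>_. u)(a := v))"
      by (simp add: card_sets[of 1, simplified])
    also have "?G 2 = (\<Sum>S :: 'n set | card S = 2. of_real t ^ 2 * pairing \<Psi> ((\<lambda>_. u)(a := v, b := v)))"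
      by (subst sum.inter_filter[symmetric]) (auto simp: P2 intro!: sum.cong)
    also have "\<dots> = of_real (real (CARD('n) choose 2) * t\<^sup>2) * pairing \<Psi> ((\<lambda>_. u)(a := v, b := v))"
      by (simp add: card_sets)
    finally have "cmod (pairing \<Psi> (\<lambda>_. u + complex_of_real t *s v) -
      (pairing \<Psi> (\<lambda>_. u) + of_real (real CARD('n) * t) * pairing \<Psi> ((\<lambda>_. u)(a := v)) +
       of_real (real (CARD('n) choose 2) * t\<^sup>2) * pairing \<Psi> ((\<lambda>_. u)(a := v, b := v))))
       = cmod (\<Sum>S\<in>UNIV. if 3 \<le> card S then ?F S else 0)"
      by (simp only: add_diff_cancel_left')
    also have "\<dots> \<le> (\<Sum>S\<in>UNIV. cmod (?P S) * \<bar>t\<bar> ^ 3)"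
    proof (rule sum_norm_le)
      fix S :: "'n set"
      have "\<bar>t\<bar> ^ card S \<le> \<bar>t\<bar> ^ 3" if "3 \<le> card S"
        using that t by (intro power_decreasing) auto
      then show "cmod (if 3 \<le> card S then ?F S else 0) \<le> cmod (?P S) * \<bar>t\<bar> ^ 3"
        by (auto simp: norm_mult norm_power mult.commute intro!: mult_right_mono)
    qed
    finally show ?thesis by (simp add: R_def sum_distrib_right)
  qed
  then show thesis using that by blast
qed

text \<open>Divide the maximality inequality at u + t v by f(u). The left side has real part 1 + N
  Re P1 t + (N choose 2) Re P2 t^2 + O(t^3); the right side is (1 + t^2 |v|^2)^(N/2) = 1 + k t^2 +
  O(t^3) with k = N |v|^2 / 2. Comparing coefficients, the ratio of k to N choose 2 is |v|^2 / (N -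
  1).\<close>

lemma nearest_product_second_order_real:
  fixes \<Psi> :: "complex^('n::finite \<Rightarrow> 'D::finite)"
  assumes \<Psi>: "sym_tensor \<Psi>" and ab: "a \<noteq> b" and u: "norm u = 1"
    and f: "pairing \<Psi> (\<lambda>_. u) \<noteq> 0"
    and max: "\<And>w. cmod (pairing \<Psi> (\<lambda>_. w)) \<le> cmod (pairing \<Psi> (\<lambda>_. u)) * norm w ^ CARD('n)"
    and v: "cip u v = 0"
  shows "Re (pairing \<Psi> ((\<lambda>_. u)(a := v)) / pairing \<Psi> (\<lambda>_. u)) = 0"
    "Re (pairing \<Psi> ((\<lambda>_. u)(a := v, b := v)) / pairing \<Psi> (\<lambda>_. u)) \<le> (norm v)\<^sup>2 / (real CARD('n) - 1)"
proof -
  let ?N = "real CARD('n)" and ?C = "real (CARD('n) choose 2)" and ?f = "pairing \<Psi> (\<lambda>_. u)"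
  define P1 where "P1 = pairing \<Psi> ((\<lambda>_. u)(a := v)) / ?f"
  define P2 where "P2 = pairing \<Psi> ((\<lambda>_. u)(a := v, b := v)) / ?f"
  define k where "k = ?N * (norm v)\<^sup>2 / 2"
  have k: "0 \<le> k" by (simp add: k_def)
  have "card {a, b} \<le> CARD('n)" by (rule card_mono) auto
  then have N: "2 \<le> CARD('n)" using ab by simp
  obtain R where R: "\<And>t. \<bar>t\<bar> \<le> 1 \<Longrightarrow> cmod (pairing \<Psi> (\<lambda>_. u + complex_of_real t *s v) -
      (?f + of_real (?N * t) * pairing \<Psi> ((\<lambda>_. u)(a := v)) +
       of_real (?C * t\<^sup>2) * pairing \<Psi> ((\<lambda>_. u)(a := v, b := v)))) \<le> R * \<bar>t\<bar> ^ 3"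
    by (rule pairing_second_order_expansion[OF \<Psi> ab, of u v]) blast
  \<comment> \<open>The radius 1 / (k + 1) secures both |t| \<le> 1, for the expansion of the
    pairing, and k t^2 \<le> 1, for the quadratic bound on the exponential.\<close>
  have le: "?N * Re P1 * t + (?C * Re P2 - k) * t\<^sup>2 \<le> (k\<^sup>2 + R / cmod ?f) * \<bar>t\<bar> ^ 3"
    if t: "\<bar>t\<bar> \<le> 1 / (k + 1)" for t
  proof -
    have t1: "\<bar>t\<bar> \<le> 1"
    proof -
      have "1 / (k + 1) \<le> 1" using k by simp
      with t show ?thesis by linarith
    qed
    have kt: "k * t\<^sup>2 \<le> 1"
    proof -
      have "t\<^sup>2 \<le> \<bar>t\<bar>"
        using t1 mult_left_mono[of "\<bar>t\<bar>" 1 "\<bar>t\<bar>"] by (simp add: power2_eq_square)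
      then have "k * t\<^sup>2 \<le> k * (1 / (k + 1))"
        using t k by (intro mult_left_mono) auto
      also have "\<dots> \<le> 1" using k by (simp add: divide_simps)
      finally show ?thesis .
    qed
    let ?w = "u + complex_of_real t *s v"
    let ?h = "pairing \<Psi> (\<lambda>_. ?w) / ?f"
    have "(norm ?w)\<^sup>2 = 1 + t\<^sup>2 * (norm v)\<^sup>2"
      using u v by (simp add: power2_norm_eq_inner inner_add_left inner_add_right inner_commute
          inner_eq_Re_cip[of u v] norm_eq_1 flip: scaleR_eq_vector_scalar)
        (simp add: power2_eq_square)
    \<comment> \<open>Passing to the exponential turns the square root and the N-th power into the
      single factor exp (k t^2), whatever the parity of N.\<close>
    also have "\<dots> \<le> exp (t\<^sup>2 * (norm v)\<^sup>2)" by (rule exp_ge_add_one_self)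
    also have "\<dots> = (exp (t\<^sup>2 * (norm v)\<^sup>2 / 2))\<^sup>2"
      by (simp add: exp_double[symmetric])
    finally have "norm ?w \<le> exp (t\<^sup>2 * (norm v)\<^sup>2 / 2)"
      by (rule power2_le_imp_le) simp
    then have "norm ?w ^ CARD('n) \<le> exp (t\<^sup>2 * (norm v)\<^sup>2 / 2) ^ CARD('n)"
      by (intro power_mono) auto
    also have "\<dots> = exp (k * t\<^sup>2)"
      by (simp add: k_def mult_ac flip: exp_of_nat_mult)
    also have "\<dots> \<le> 1 + k * t\<^sup>2 + (k * t\<^sup>2)\<^sup>2"
      using k kt by (intro exp_bound) auto
    also have "(k * t\<^sup>2)\<^sup>2 \<le> k\<^sup>2 * \<bar>t\<bar> ^ 3"
    proof -
      have "\<bar>t\<bar> ^ 4 \<le> \<bar>t\<bar> ^ 3" using t1 by (intro power_decreasing) auto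
      then show ?thesis
        by (simp add: power_mult_distrib mult_left_mono flip: power_mult)
    qed
    finally have upper: "norm ?w ^ CARD('n) \<le> 1 + k * t\<^sup>2 + k\<^sup>2 * \<bar>t\<bar> ^ 3" by simp
    have "Re ?h \<le> cmod ?h" by (rule complex_Re_le_cmod)
    also have "\<dots> \<le> norm ?w ^ CARD('n)"
      using max[of ?w] f by (simp add: norm_divide divide_simps mult.commute)
    finally have "Re ?h \<le> 1 + k * t\<^sup>2 + k\<^sup>2 * \<bar>t\<bar> ^ 3"
      using upper by simp
    moreover have "cmod (?h - (1 + of_real (?N * t) * P1 + of_real (?C * t\<^sup>2) * P2)) \<le> R / cmod ?f * \<bar>t\<bar> ^ 3"
    proof -
      have "?h - (1 + of_real (?N * t) * P1 + of_real (?C * t\<^sup>2) * P2)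
         = (pairing \<Psi> (\<lambda>_. ?w) - (?f + of_real (?N * t) * pairing \<Psi> ((\<lambda>_. u)(a := v)) +
       of_real (?C * t\<^sup>2) * pairing \<Psi> ((\<lambda>_. u)(a := v, b := v)))) / ?f"
        using f by (simp add: P1_def P2_def diff_divide_distrib add_divide_distrib)
      then show ?thesis
        using R[OF t1] f by (simp add: norm_divide divide_right_mono)
    qed
    then have "Re (1 + of_real (?N * t) * P1 + of_real (?C * t\<^sup>2) * P2 - ?h) \<le> R / cmod ?f * \<bar>t\<bar> ^ 3"
      by (intro order_trans[OF complex_Re_le_cmod]) (simp only: norm_minus_commute)
    ultimately show ?thesis
      by (simp add: algebra_simps)
  qed
  have pos: "0 < 1 / (k + 1)" using k by simp
  have "?N * Re P1 = 0" "?C * Re P2 - k \<le> 0"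
    using second_order_sign[OF pos le] by auto
  moreover have "?C = ?N * (?N - 1) / 2"
    using N by (simp add: choose_two real_of_nat_div of_nat_diff)
  ultimately have "Re P1 = 0" "?N * ((?N - 1) * Re P2) \<le> ?N * (norm v)\<^sup>2"
    using N by (auto simp: k_def)
  moreover from this(2) have "(?N - 1) * Re P2 \<le> (norm v)\<^sup>2"
    using N by (simp add: mult_le_cancel_left_pos)
  ultimately show "Re (pairing \<Psi> ((\<lambda>_. u)(a := v)) / ?f) = 0"
    "Re (pairing \<Psi> ((\<lambda>_. u)(a := v, b := v)) / ?f) \<le> (norm v)\<^sup>2 / (?N - 1)"
    using N by (auto simp: P1_def P2_def pos_le_divide_eq mult.commute)
qed

text \<open>The real conditions are applied to v and to \<i> v. The first-order term is multiplied
  by \<i>, so its real and imaginary parts both vanish; the second-order term changes sign, so the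
  one-sided bound becomes two-sided.\<close>

lemma nearest_product_second_order:
  fixes \<Psi> :: "complex^('n::finite \<Rightarrow> 'D::finite)"
  assumes \<Psi>: "sym_tensor \<Psi>" and ab: "a \<noteq> b" and u: "norm u = 1"
    and f: "pairing \<Psi> (\<lambda>_. u) \<noteq> 0"
    and max: "\<And>w. cmod (pairing \<Psi> (\<lambda>_. w)) \<le> cmod (pairing \<Psi> (\<lambda>_. u)) * norm w ^ CARD('n)"
    and v: "cip u v = 0"
  shows "pairing \<Psi> ((\<lambda>_. u)(a := v)) = 0"
    "\<bar>Re (pairing \<Psi> ((\<lambda>_. u)(a := v, b := v)) / pairing \<Psi> (\<lambda>_. u))\<bar> \<le> (norm v)\<^sup>2 / (real CARD('n) - 1)"
proof -
  let ?f = "pairing \<Psi> (\<lambda>_. u)"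
  note main = nearest_product_second_order_real[OF \<Psi> ab u f max]
  have iv: "cip u (\<i> *s v) = 0" using v by (simp add: cip_scale_right)
  have "Re (pairing \<Psi> ((\<lambda>_. u)(a := v)) / ?f) = 0"
    "Re (pairing \<Psi> ((\<lambda>_. u)(a := \<i> *s v)) / ?f) = 0"
    using main(1) v iv by blast+
  then have "pairing \<Psi> ((\<lambda>_. u)(a := v)) / ?f = 0"
    by (simp add: pairing_scale complex_eq_iff flip: times_divide_eq_right)
  then show "pairing \<Psi> ((\<lambda>_. u)(a := v)) = 0" using f by simp
  have "pairing \<Psi> ((\<lambda>_. u)(a := \<i> *s v, b := \<i> *s v)) = - pairing \<Psi> ((\<lambda>_. u)(a := v, b := v))"
  proof -
    have "pairing \<Psi> ((\<lambda>_. u)(a := \<i> *s v, b := \<i> *s v)) = \<i> * pairing \<Psi> ((\<lambda>_. u)(b := v, a := \<i> *s v))"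
      by (subst fun_upd_twist[OF ab[symmetric]]) (rule pairing_scale)
    also have "\<dots> = \<i> * (\<i> * pairing \<Psi> ((\<lambda>_. u)(b := v, a := v)))"
      by (simp only: pairing_scale)
    also have "\<dots> = - pairing \<Psi> ((\<lambda>_. u)(a := v, b := v))"
      by (subst fun_upd_twist[OF ab]) simp
    finally show ?thesis .
  qed
  then show "\<bar>Re (pairing \<Psi> ((\<lambda>_. u)(a := v, b := v)) / ?f)\<bar> \<le> (norm v)\<^sup>2 / (real CARD('n) - 1)"
    using main(2)[OF v] main(2)[OF iv] by (simp add: norm_vector_scalar)
qed

text \<open>Removing the component along u \<otimes> u leaves the compression \<gamma> of \<beta> to
  the complement of \<open>u\<close>, because the cross terms vanish by \<open>orth\<close>.
  Polarisation bounds \<gamma> by \<open>c\<close>, so the row of \<open>axis p 1\<close> has norm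
  at most c |proj e_p|. The squares of |proj e_p| add up to D - 1, the dimension of the
  complement.\<close>

lemma complex_bilinear_hs_bound:
  fixes \<beta> :: "complex^'D \<Rightarrow> complex^'D \<Rightarrow> complex"
  assumes add: "\<And>v v' w. \<beta> (v + v') w = \<beta> v w + \<beta> v' w"
    and scale: "\<And>c v w. \<beta> (c *s v) w = c * \<beta> v w"
    and sym: "\<And>v w. \<beta> v w = \<beta> w v"
    and u: "norm u = 1" "\<beta> u u = 1" and orth: "\<And>v. cip u v = 0 \<Longrightarrow> \<beta> v u = 0"
    and bound: "\<And>v. cip u v = 0 \<Longrightarrow> \<bar>Re (\<beta> v v)\<bar> \<le> c * (norm v)\<^sup>2" and c: "0 \<le> c"
  shows "(\<Sum>p\<in>UNIV. \<Sum>q\<in>UNIV. (cmod (\<beta> (axis p 1) (axis q 1) - cnj (u $ p) * cnj (u $ q)))\<^sup>2)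
    \<le> c\<^sup>2 * (real CARD('D) - 1)"
proof -
  define proj where "proj v = v - cip u v *s u" for v
  define \<gamma> where "\<gamma> v w = \<beta> (proj v) (proj w)" for v w
  have uu: "cip u u = 1" using u by (simp add: cip_self)
  have perp: "cip u (proj v) = 0" for v
    by (simp add: proj_def cip_diff_right cip_scale_right uu)
  have proj_add: "proj (v + w) = proj v + proj w" and proj_scale: "proj (z *s v) = z *s proj v" for v w z
    by (simp_all add: proj_def cip_add_right cip_scale_right vec_eq_iff algebra_simps)
  have proj_proj: "proj (proj v) = proj v" for v
    using perp[of v] by (simp add: proj_def[of "proj v"])
  have norm_proj: "(norm (proj v))\<^sup>2 = (norm v)\<^sup>2 - (cmod (cip u v))\<^sup>2" for v
  proof -
    have "complex_of_real ((norm (proj v))\<^sup>2) = cip (proj v) (proj v)"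
      by (rule cip_self[symmetric])
    also have "\<dots> = cip v v - cip u v * cip v u"
      by (simp add: proj_def cip_diff_left cip_diff_right cip_scale_left
          cip_scale_right uu algebra_simps)
    also have "\<dots> = complex_of_real ((norm v)\<^sup>2 - (cmod (cip u v))\<^sup>2)"
      by (simp add: cip_self cip_commute[of v u] complex_norm_square del: of_real_power)
    finally show ?thesis by (simp only: of_real_eq_iff)
  qed
  have add2: "\<beta> w (v + v') = \<beta> w v + \<beta> w v'" and scale2: "\<beta> w (z *s v) = z * \<beta> w v" for v v' w z
    using add scale sym by metis+
  have \<gamma>: "\<gamma> v w = \<beta> v w - cip u v * cip u w" for v w
  proof -
    have "\<beta> v w = \<beta> (proj v + cip u v *s u) (proj w + cip u w *s u)"
      by (simp add: proj_def)
    also have "\<dots> = \<gamma> v w + cip u v * cip u w"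
    proof -
      have "\<beta> (proj v) u = 0" "\<beta> u (proj w) = 0"
        using orth[OF perp] sym by metis+
      then show ?thesis
        by (simp only: add add2 scale scale2 \<gamma>_def u(2)) simp
    qed
    finally show ?thesis by simp
  qed
  have "bilinear (\<lambda>v w. Re (\<gamma> v w))"
    unfolding bilinear_def
    by (auto intro!: linearI simp: \<gamma>_def proj_add proj_scale add add2 scale scale2 scaleR_eq_vector_scalar)
  moreover have "Re (\<gamma> v w) = Re (\<gamma> w v)" for v w
    by (simp add: \<gamma>_def sym)
  moreover have "\<bar>Re (\<gamma> v v)\<bar> \<le> c * (norm v)\<^sup>2" for v
  proof -
    have "\<bar>Re (\<gamma> v v)\<bar> \<le> c * (norm (proj v))\<^sup>2"
      unfolding \<gamma>_def by (rule bound[OF perp])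
    also have "\<dots> \<le> c * (norm v)\<^sup>2"
      using c by (intro mult_left_mono) (auto simp: norm_proj)
    finally show ?thesis .
  qed
  ultimately have re: "\<bar>Re (\<gamma> v w)\<bar> \<le> c * norm v * norm w" for v w
    by (rule symmetric_bilinear_bound)
  have row: "(\<Sum>q\<in>UNIV. (cmod (\<gamma> v (axis q 1)))\<^sup>2) \<le> c\<^sup>2 * (norm (proj v))\<^sup>2" for v
  proof -
    \<comment> \<open>The conjugated row, chosen so that \<gamma> v w is the squared norm of the
      row; being real, it is controlled by the bound on real parts.\<close>
    define w where "w = (\<chi> q. cnj (\<gamma> v (axis q 1)))"
    have "\<gamma> v w = (\<Sum>q\<in>UNIV. w $ q * \<gamma> v (axis q 1))"
    proof -
      interpret Modules.additive "\<gamma> v"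
        by standard (simp add: \<gamma>_def proj_add add2)
      have "\<gamma> v w = \<gamma> v (\<Sum>q\<in>UNIV. w $ q *s axis q 1)"
        by (simp add: basis_expansion)
      also have "\<dots> = (\<Sum>q\<in>UNIV. w $ q * \<gamma> v (axis q 1))"
        by (simp add: sum) (simp add: \<gamma>_def proj_scale scale2)
      finally show ?thesis .
    qed
    also have "\<dots> = cip w w"
      by (simp add: w_def cip_def mult.commute)
    also have "\<dots> = complex_of_real ((norm w)\<^sup>2)"
      by (rule cip_self)
    \<comment> \<open>Replacing v by its projection leaves \<gamma> unchanged but brings the norm of
      \<open>proj v\<close> into the bound, which yields D - 1 instead of D.\<close>
    finally have "Re (\<gamma> (proj v) w) = (norm w)\<^sup>2"
      by (simp add: \<gamma>_def proj_proj)
    then have "norm w * norm w \<le> norm w * (c * norm (proj v))"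
      using re[of "proj v" w] by (simp add: power2_eq_square mult_ac)
    then have "norm w \<le> c * norm (proj v)"
      using c by (cases "norm w = 0") auto
    then have "(norm w)\<^sup>2 \<le> (c * norm (proj v))\<^sup>2"
      by (intro power_mono) auto
    moreover have "(norm w)\<^sup>2 = (\<Sum>q\<in>UNIV. (cmod (\<gamma> v (axis q 1)))\<^sup>2)"
      by (simp add: w_def norm_vec_def L2_set_def sum_nonneg)
    ultimately show ?thesis by (simp add: power_mult_distrib)
  qed
  have cip_axis: "cip u (axis p 1) = cnj (u $ p)" for p
    by (simp add: cip_def axis_def if_distrib[of "\<lambda>z. _ * z"] cong: if_cong)
  have "(\<Sum>p\<in>UNIV. \<Sum>q\<in>UNIV. (cmod (\<gamma> (axis p 1) (axis q 1)))\<^sup>2)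
      \<le> (\<Sum>p\<in>UNIV. c\<^sup>2 * (1 - (cmod (u $ p))\<^sup>2))"
    by (intro sum_mono order_trans[OF row]) (simp add: norm_proj cip_axis)
  also have "\<dots> = c\<^sup>2 * (real CARD('D) - (\<Sum>p\<in>UNIV. (cmod (u $ p))\<^sup>2))"
    by (simp add: sum_subtractf flip: sum_distrib_left)
  also have "(\<Sum>p\<in>UNIV. (cmod (u $ p))\<^sup>2) = (norm u)\<^sup>2"
    by (simp add: norm_vec_def L2_set_def sum_nonneg)
  finally show ?thesis
    using u by (simp add: \<gamma> cip_axis)
qed

section \<open>Two-site energy of a symmetric tensor\<close>

text \<open>The operator K on sites \<open>a\<close> and \<open>b\<close>, in this order, tensored
  with the identity on all other sites.\<close>

definition lift_pair :: "'n \<Rightarrow> 'n \<Rightarrow> complex^('D::finite \<times> 'D)^('D \<times> 'D)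
    \<Rightarrow> complex^('n::finite \<Rightarrow> 'D)^('n \<Rightarrow> 'D)" where
  "lift_pair a b K = (\<chi> x y. if \<forall>k. k \<noteq> a \<longrightarrow> k \<noteq> b \<longrightarrow> x k = y k
     then K $ (x a, x b) $ (y a, y b) else 0)"

definition tensor_square :: "complex^'D::finite \<Rightarrow> complex^('D \<times> 'D)" where
  "tensor_square u = (\<chi> r. u $ fst r * u $ snd r)"

definition product_vector :: "complex^'D::finite \<Rightarrow> complex^('n::finite \<Rightarrow> 'D)" where
  "product_vector u = (\<chi> x. \<Prod>k\<in>UNIV. u $ x k)"

lemma cip_product_vector: "cip \<Psi> (product_vector u) = pairing \<Psi> (\<lambda>_. u)"
  by (simp add: cip_def product_vector_def pairing_def)

lemma norm_tensor_square: "norm (tensor_square u) = (norm u)\<^sup>2"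
proof -
  have "cip (tensor_square u) (tensor_square u) = cip u u * cip u u"
    by (simp add: cip_def tensor_square_def sum_product sum.cartesian_product case_prod_beta mult_ac
        flip: UNIV_Times_UNIV)
  then have "complex_of_real ((norm (tensor_square u))\<^sup>2) = complex_of_real (((norm u)\<^sup>2)\<^sup>2)"
    by (simp add: cip_self power2_eq_square)
  then show ?thesis
    by (simp only: of_real_eq_iff power2_eq_iff_nonneg norm_ge_zero zero_le_power2)
qed

lemma sum_agreeing_off_pair:
  fixes x :: "'n::finite \<Rightarrow> 'D::finite" and F :: "('n \<Rightarrow> 'D) \<Rightarrow> complex"
  assumes "a \<noteq> b"
  shows "(\<Sum>y\<in>UNIV. if \<forall>k. k \<noteq> a \<longrightarrow> k \<noteq> b \<longrightarrow> x k = y k then F y else 0)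
    = (\<Sum>r\<in>UNIV. F (x(a := fst r, b := snd r)))"
proof -
  have "(\<Sum>y\<in>UNIV. if \<forall>k. k \<noteq> a \<longrightarrow> k \<noteq> b \<longrightarrow> x k = y k then F y else 0)
      = (\<Sum>y | \<forall>k. k \<noteq> a \<longrightarrow> k \<noteq> b \<longrightarrow> x k = y k. F y)"
    by (simp add: sum.If_cases)
  also have "\<dots> = (\<Sum>r\<in>UNIV. F (x(a := fst r, b := snd r)))"
    using assms by (intro sum.reindex_bij_witness[of _ "\<lambda>r. x(a := fst r, b := snd r)" "\<lambda>y. (y a, y b)"])
      (auto simp: fun_eq_iff intro!: arg_cong[where f = F])
  finally show ?thesis .
qed

lemma lift_pair_vec:
  assumes "a \<noteq> b"
  shows "(lift_pair a b K *v \<Phi>) $ x = (\<Sum>r\<in>UNIV. K $ (x a, x b) $ r * \<Phi> $ (x(a := fst r, b := snd r)))"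
  using assms sum_agreeing_off_pair[of a b x "\<lambda>y. K $ (x a, x b) $ (y a, y b) * \<Phi> $ y"]
  by (simp add: lift_pair_def matrix_vector_mult_def if_distrib[of "\<lambda>z. z * _"] cong: if_cong)

lemma dagger_lift_pair:
  assumes "dagger K = K"
  shows "dagger (lift_pair a b K) = lift_pair a b K"
proof -
  have "cnj (K $ r $ s) = K $ s $ r" for r s
    using arg_cong[OF assms, of "\<lambda>M. M $ s $ r"] by (simp add: dagger_def)
  then show ?thesis
    by (auto simp: dagger_def lift_pair_def vec_eq_iff)
qed

lemma prod_split_pair:
  assumes "a \<noteq> (b :: 'n::finite)"
  shows "(\<Prod>k\<in>UNIV. h k) = h a * h b * (\<Prod>k\<in>UNIV - {a, b}. h k :: complex)"
proof -
  have "(\<Prod>k\<in>UNIV. h k) = h a * (\<Prod>k\<in>UNIV - {a}. h k)"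
    by (rule prod.remove) auto
  also have "(\<Prod>k\<in>UNIV - {a}. h k) = h b * (\<Prod>k\<in>UNIV - {a} - {b}. h k)"
    using assms by (intro prod.remove) auto
  finally show ?thesis
    by (simp add: Diff_insert2[symmetric] mult.assoc insert_commute)
qed

text \<open>Basis vectors at \<open>a\<close> and \<open>b\<close> read off the coordinates of
  \<Psi> contracted with \<open>u\<close> at the other sites. Summed against \<open>G\<close>, they
  give the pairing of \<Psi> with the tensor that is \<open>G\<close> on \<open>a\<close>,
  \<open>b\<close> and \<open>u\<close> elsewhere.\<close>

lemma pairing_pair_axes:
  assumes "a \<noteq> b"
  shows "(\<Sum>r\<in>UNIV. G r * pairing \<Psi> ((\<lambda>_. u)(a := axis (fst r) 1, b := axis (snd r) 1)))
    = (\<Sum>x\<in>UNIV. cnj (\<Psi> $ x) * (G (x a, x b) * (\<Prod>k\<in>UNIV - {a, b}. u $ x k)))"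
proof -
  have prod: "(\<Prod>k\<in>UNIV. ((\<lambda>_. u)(a := axis (fst r) 1, b := axis (snd r) 1)) k $ x k)
     = (if r = (x a, x b) then \<Prod>k\<in>UNIV - {a, b}. u $ x k else 0)" for r x
    using assms by (subst prod_split_pair[OF assms]) (auto simp: axis_def prod_eq_iff)
  show ?thesis
    by (simp only: pairing_def prod sum_distrib_left, subst sum.swap)
      (simp add: if_distrib[of "\<lambda>z. _ * z"] mult_ac cong: if_cong)
qed

text \<open>The lifted operator acts on a product vector only at the two sites, giving K (u
  \<otimes> u) there and \<open>u\<close> elsewhere.\<close>

lemma cip_lift_product_vector:
  assumes ab: "a \<noteq> b"
  shows "cip \<Psi> (lift_pair a b K *v product_vector u)
    = (\<Sum>r\<in>UNIV. (K *v tensor_square u) $ r * pairing \<Psi> ((\<lambda>_. u)(a := axis (fst r) 1, b := axis (snd r) 1)))"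
proof -
  have "(lift_pair a b K *v product_vector u) $ x
      = (K *v tensor_square u) $ (x a, x b) * (\<Prod>k\<in>UNIV - {a, b}. u $ x k)" for x
  proof -
    have "product_vector u $ (x(a := fst r, b := snd r)) = tensor_square u $ r * (\<Prod>k\<in>UNIV - {a, b}. u $ x k)" for r
      unfolding product_vector_def tensor_square_def
      using ab by (simp add: prod_split_pair[OF ab])
    then show ?thesis
      unfolding lift_pair_vec[OF ab] by (simp add: matrix_vector_mult_def sum_distrib_right mult.assoc)
  qed
  then show ?thesis
    by (simp add: pairing_pair_axes[OF ab] cip_def)
qed

lemma subspace_sym_tensor: "subspace {\<Psi>. sym_tensor \<Psi>}"
  by (auto simp: subspace_def sym_tensor_def)

theorem symmetric_pair_energy_bound:
  fixes K :: "complex^('D::finite \<times> 'D)^('D \<times> 'D)" and \<Psi>0 :: "complex^('n::finite \<Rightarrow> 'D)"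
  assumes ab: "a \<noteq> b" and K: "dagger K = K"
    and range: "\<And>v. l * (norm v)\<^sup>2 \<le> inner v (K *v v)" "\<And>v. inner v (K *v v) \<le> r * (norm v)\<^sup>2"
    and prod: "\<And>w. norm w = 1 \<Longrightarrow> inner (tensor_square w) (K *v tensor_square w) \<le> e"
    and \<Psi>0: "sym_tensor \<Psi>0" "norm \<Psi>0 = 1"
  shows "inner \<Psi>0 (lift_pair a b K *v \<Psi>0) \<le> e + (r - l) * sqrt (real CARD('D) - 1) / (2 * (real CARD('n) - 1))"
proof -
  let ?L = "lift_pair a b K" and ?N = "real CARD('n)" and ?D = "real CARD('D)"
  have "card {a, b} \<le> CARD('n)" by (rule card_mono) auto
  then have N: "2 \<le> ?N" using ab by simp
  have self: "inner x (?L *v y) = inner (?L *v x) y" for x y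
    by (simp add: inner_matrix_vector dagger_lift_pair[OF K])
  have "\<Psi>0 \<noteq> 0" using \<Psi>0 by auto
  \<comment> \<open>The maximiser replaces \<open>\<Psi>0\<close>, whose energy is at most E by
    \<open>max\<close>. It need not be an eigenvector, since the lift need not preserve symmetric
    tensors; stationarity against symmetric tensors suffices.\<close>
  obtain \<Psi> E where \<Psi>: "\<Psi> \<in> {\<Psi>. sym_tensor \<Psi>}" "norm \<Psi> = 1"
    and max: "\<And>w. w \<in> {\<Psi>. sym_tensor \<Psi>} \<Longrightarrow> inner w (?L *v w) \<le> E * inner w w"
    and stat: "\<And>w. w \<in> {\<Psi>. sym_tensor \<Psi>} \<Longrightarrow> inner w (?L *v \<Psi>) = E * inner w \<Psi>"
    by (rule self_adjoint_max_on_subspace[OF linear_matrix_vector self subspace_sym_tensor _ \<open>\<Psi>0 \<noteq> 0\<close>])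
      (use \<Psi>0 in auto)
  have sym: "sym_tensor \<Psi>" "\<Psi> \<noteq> 0" using \<Psi> by auto
  obtain u where u: "norm u = 1" and f: "pairing \<Psi> (\<lambda>_. u) \<noteq> 0"
    and umax: "\<And>w. cmod (pairing \<Psi> (\<lambda>_. w)) \<le> cmod (pairing \<Psi> (\<lambda>_. u)) * norm w ^ CARD('n)"
    using exists_nearest_product[OF sym] by blast
  let ?f = "pairing \<Psi> (\<lambda>_. u)"
  define \<beta> where "\<beta> v w = pairing \<Psi> ((\<lambda>_. u)(a := v, b := w)) / ?f" for v w
  define c where "c = 1 / (?N - 1)"
  \<comment> \<open>The conjugates appear because \<open>pairing\<close> is conjugate-linear in
    \<Psi>: the contraction is a linear form on pairs of vectors, and the part to subtract is the
    form v, w \<mapsto> <u,v> <u,w>.\<close>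
  define A where "A = (\<chi> r. \<beta> (axis (fst r) 1) (axis (snd r) 1) - cnj (u $ fst r) * cnj (u $ snd r))"
  have twist: "(\<lambda>_. u)(a := v, b := w) = (\<lambda>_. u)(b := w, a := v)" for v w :: "complex^'D"
    using ab by (rule fun_upd_twist)
  have au: "(\<lambda>_. u)(a := u) = (\<lambda>_. u)" "(\<lambda>_. u)(b := u) = (\<lambda>_. u)" by auto
  note second = nearest_product_second_order[OF sym(1) ab u f umax]
  have \<beta>_sym: "\<beta> v w = \<beta> w v" for v w
  proof -
    have "(\<lambda>_. u)(a := v, b := w) \<circ> Transposition.transpose a b = (\<lambda>_. u)(a := w, b := v)"
      using ab by (auto simp: fun_eq_iff Transposition.transpose_def)
    then show ?thesis
      using pairing_permute[OF sym(1), of "Transposition.transpose a b" "(\<lambda>_. u)(a := v, b := w)"]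
      by (simp add: \<beta>_def)
  qed
  have "(\<Sum>p\<in>UNIV. \<Sum>q\<in>UNIV. (cmod (\<beta> (axis p 1) (axis q 1) - cnj (u $ p) * cnj (u $ q)))\<^sup>2)
      \<le> c\<^sup>2 * (?D - 1)"
  proof (rule complex_bilinear_hs_bound[OF _ _ \<beta>_sym u])
    show "\<beta> (v + v') w = \<beta> v w + \<beta> v' w" "\<beta> (z *s v) w = z * \<beta> v w" for v v' w z
      by (simp_all add: \<beta>_def twist pairing_add pairing_scale add_divide_distrib)
    show "\<beta> u u = 1" using f by (simp add: \<beta>_def au)
    show "\<beta> v u = 0" if "cip u v = 0" for v
      using second(1)[OF that] by (simp add: \<beta>_def twist au)
    show "\<bar>Re (\<beta> v v)\<bar> \<le> c * (norm v)\<^sup>2" if "cip u v = 0" for v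
      using second(2)[OF that] by (simp add: \<beta>_def c_def)
    show "0 \<le> c" using N by (simp add: c_def)
  qed
  also have "(\<Sum>p\<in>UNIV. \<Sum>q\<in>UNIV. (cmod (\<beta> (axis p 1) (axis q 1) - cnj (u $ p) * cnj (u $ q)))\<^sup>2) = (norm A)\<^sup>2"
    by (simp add: A_def norm_vec_def L2_set_def sum_nonneg sum.cartesian_product case_prod_beta
        flip: UNIV_Times_UNIV)
  finally have "(norm A)\<^sup>2 \<le> (c * sqrt (?D - 1))\<^sup>2"
    by (simp add: power_mult_distrib)
  then have normA: "norm A \<le> c * sqrt (?D - 1)"
    using N by (rule_tac power2_le_imp_le) (auto simp: c_def)
  let ?G = "K *v tensor_square u"
  have fE: "cip \<Psi> (?L *v product_vector u) = complex_of_real E * ?f"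
  proof -
    have pv: "sym_tensor (z *s product_vector u :: complex^('n \<Rightarrow> 'D))" for z
    proof -
      have "(\<Prod>k\<in>UNIV. u $ (x \<circ> \<pi>) k) = (\<Prod>k\<in>UNIV. u $ x k)" if "bij \<pi>" for x :: "'n \<Rightarrow> 'D" and \<pi>
        using that by (intro prod.reindex_bij_witness[of _ "inv \<pi>" \<pi>]) (auto simp: bij_def surj_f_inv_f)
      then show ?thesis by (auto simp: sym_tensor_def product_vector_def)
    qed
    \<comment> \<open>Stationarity is an identity of real parts. Testing it on the product vector
      and on \<i> times that vector gives the complex identity.\<close>
    have "inner (1 *s product_vector u) (?L *v \<Psi>) = E * inner (1 *s product_vector u) \<Psi>"
      "inner (\<i> *s product_vector u) (?L *v \<Psi>) = E * inner (\<i> *s product_vector u) \<Psi>"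
      using stat pv by blast+
    then have "cip (product_vector u) (?L *v \<Psi>) = of_real E * cip (product_vector u) \<Psi>"
      by (simp add: inner_ii_left complex_eq_iff) (simp add: inner_eq_Re_cip)
    then have "cip (?L *v \<Psi>) (product_vector u) = of_real E * cip \<Psi> (product_vector u)"
      using cip_commute[of "?L *v \<Psi>" "product_vector u"] cip_commute[of \<Psi> "product_vector u"] by simp
    then show ?thesis
      by (simp add: cip_matrix_vector dagger_lift_pair[OF K] cip_product_vector)
  qed
  have "complex_of_real E = (\<Sum>r\<in>UNIV. ?G $ r * \<beta> (axis (fst r) 1) (axis (snd r) 1))"
    using fE f unfolding cip_lift_product_vector[OF ab] \<beta>_def
    by (simp add: field_simps flip: sum_divide_distrib)
  also have "\<dots> = (\<Sum>r\<in>UNIV. cnj (tensor_square u $ r) * ?G $ r) + (\<Sum>r\<in>UNIV. A $ r * ?G $ r)"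
    by (simp add: A_def tensor_square_def algebra_simps flip: sum.distrib)
  finally have E: "complex_of_real E = cip (tensor_square u) ?G + (\<Sum>r\<in>UNIV. A $ r * ?G $ r)"
    by (simp add: cip_def)
  \<comment> \<open>The midpoint of the range of K, so that K - m has norm at most (r - l) / 2.
    Since \<open>B\<close> is orthogonal to u \<otimes> u, replacing K by K - m does not alter the
    error term.\<close>
  define m where "m = (l + r) / 2"
  define B where "B = (\<chi> r. cnj (A $ r))"
  have B0: "cip B (tensor_square u) = 0"
  proof -
    have "(\<Sum>r\<in>UNIV. tensor_square u $ r * pairing \<Psi> ((\<lambda>_. u)(a := axis (fst r) 1, b := axis (snd r) 1))) = ?f"
      unfolding pairing_pair_axes[OF ab]
      by (simp add: pairing_def prod_split_pair[OF ab] tensor_square_def)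
    then have "(\<Sum>r\<in>UNIV. tensor_square u $ r * \<beta> (axis (fst r) 1) (axis (snd r) 1)) = 1"
      using f by (simp add: \<beta>_def flip: sum_divide_distrib)
    moreover have "cip (tensor_square u) (tensor_square u) = 1"
      using u by (simp add: cip_self norm_tensor_square)
    moreover have "cip B (tensor_square u) = (\<Sum>r\<in>UNIV. tensor_square u $ r * \<beta> (axis (fst r) 1) (axis (snd r) 1))
        - cip (tensor_square u) (tensor_square u)"
      by (simp add: cip_def B_def A_def tensor_square_def algebra_simps flip: sum_subtractf)
    ultimately show ?thesis by simp
  qed
  have mat_vec: "mat (complex_of_real m) *v v = m *\<^sub>R v" for v :: "complex^('D \<times> 'D)"
    by (simp add: matrix_vector_mult_def mat_def vec_eq_iff if_distrib[of "\<lambda>z. z * _"]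
        scaleR_eq_vector_scalar cong: if_cong)
  have G': "norm ((K - mat (of_real m)) *v tensor_square u) \<le> (r - l) / 2 * norm (tensor_square u)"
  proof (rule hermitian_norm_bound)
    show "dagger (K - mat (of_real m)) = K - mat (of_real m)"
      using K by (simp add: dagger_diff) (simp add: dagger_def mat_def vec_eq_iff)
    show "\<bar>inner v ((K - mat (of_real m)) *v v)\<bar> \<le> (r - l) / 2 * (norm v)\<^sup>2" for v
    proof -
      have "inner v ((K - mat (of_real m)) *v v) = inner v (K *v v) - m * (norm v)\<^sup>2"
        by (simp add: matrix_vector_mult_diff_rdistrib inner_diff_right mat_vec dot_square_norm)
      then show ?thesis
        using range[of v] by (simp add: m_def abs_le_iff field_simps)
    qed
  qed
  have "E = inner (tensor_square u) ?G + Re (cip B ?G)"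
    using arg_cong[OF E, of Re] by (simp add: B_def cip_def inner_eq_Re_cip)
  also have "cip B ?G = cip B ((K - mat (of_real m)) *v tensor_square u)"
    by (simp add: matrix_vector_mult_diff_rdistrib cip_diff_right mat_vec scaleR_eq_vector_scalar
        cip_scale_right B0)
  also have "Re \<dots> \<le> norm B * norm ((K - mat (of_real m)) *v tensor_square u)"
    using norm_cauchy_schwarz by (simp add: inner_eq_Re_cip[symmetric])
  also have "\<dots> \<le> norm B * ((r - l) / 2)"
    using G' u by (intro mult_left_mono) (auto simp: norm_tensor_square)
  also have "norm B = norm A"
    by (simp add: B_def norm_vec_def)
  finally have "E \<le> e + norm A * ((r - l) / 2)"
    using prod[OF u] by simp
  also have "norm A * ((r - l) / 2) \<le> c * sqrt (?D - 1) * ((r - l) / 2)"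
    using normA range[of "tensor_square u"] u by (intro mult_right_mono) (auto simp: norm_tensor_square)
  also have "\<dots> = (r - l) * sqrt (?D - 1) / (2 * (?N - 1))"
    by (simp add: c_def mult_ac)
  finally show ?thesis
    using max[of \<Psi>0] \<Psi>0 by (simp add: dot_square_norm)
qed

section \<open>Density matrices and marginals\<close>

lemma cnj_entry_hermitian: "dagger A = A \<Longrightarrow> cnj (A $ i $ j) = A $ j $ i"
  by (drule arg_cong[of _ _ "\<lambda>M. M $ j $ i"]) (simp add: dagger_def)

text \<open>For Hermitian \<open>H\<close> the real inner product of matrices is the expectation Re
  tr (H X), the linear functional used in the separation argument.\<close>

lemma inner_hermitian_matrix:
  assumes "dagger H = H"
  shows "inner H X = Re (\<Sum>i\<in>UNIV. \<Sum>j\<in>UNIV. H $ i $ j * X $ j $ i)"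
proof -
  have "inner H X = Re (\<Sum>i\<in>UNIV. \<Sum>j\<in>UNIV. cnj (H $ i $ j) * X $ i $ j)"
    by (simp add: inner_vec_def inner_complex_def)
  also have "(\<Sum>i\<in>UNIV. \<Sum>j\<in>UNIV. cnj (H $ i $ j) * X $ i $ j) = (\<Sum>i\<in>UNIV. \<Sum>j\<in>UNIV. H $ j $ i * X $ i $ j)"
    by (simp only: cnj_entry_hermitian[OF assms])
  also have "\<dots> = (\<Sum>i\<in>UNIV. \<Sum>j\<in>UNIV. H $ i $ j * X $ j $ i)"
    by (rule sum.swap)
  finally show ?thesis .
qed

lemma inner_dagger_hermitian:
  assumes "dagger X = X"
  shows "inner (dagger A) X = inner A X"
proof -
  have "inner (dagger A) X = inner X (dagger A)" by (rule inner_commute)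
  also have "\<dots> = Re (\<Sum>i\<in>UNIV. \<Sum>j\<in>UNIV. X $ i $ j * cnj (A $ i $ j))"
    by (simp add: inner_hermitian_matrix[OF assms] dagger_def)
  also have "\<dots> = inner X A"
    by (simp add: inner_vec_def inner_complex_def)
  finally show ?thesis by (simp add: inner_commute)
qed

lemma trace_mult_dagger: "trace (M ** dagger M) = complex_of_real ((norm M)\<^sup>2)"
proof -
  have "complex_of_real ((norm M)\<^sup>2) = (\<Sum>i\<in>UNIV. complex_of_real ((norm (M $ i))\<^sup>2))"
    by (simp add: norm_vec_def[of M] L2_set_def sum_nonneg)
  also have "\<dots> = (\<Sum>i\<in>UNIV. cip (M $ i) (M $ i))"
    by (simp only: cip_self)
  also have "\<dots> = trace (M ** dagger M)"
    by (simp add: cip_def trace_def matrix_matrix_mult_def dagger_def mult.commute)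
  finally show ?thesis ..
qed

lemma density_mult_dagger: "norm M = 1 \<Longrightarrow> density (M ** dagger M)"
  using psd_dagger_mult[of "dagger M"] by (simp add: density_def trace_mult_dagger)

section \<open>The compact convex set of density matrices\<close>

text \<open>M is the positive square root; tr A = 1 says that its Hilbert-Schmidt norm is 1.
  Positivity of M is recorded because uniqueness of the square root later transfers permutation
  invariance from A to M.\<close>

lemma density_eq_square:
  assumes "density A"
  obtains M where "psd M" "norm M = 1" "A = M ** dagger M"
proof -
  let ?M = "psd_sqrt A"
  have M: "psd ?M" "?M ** ?M = A"
    using assms psd_sqrt_properties by (auto simp: density_def)
  then have A: "A = ?M ** dagger ?M"
    by (simp add: psd_def)
  then have "complex_of_real ((norm ?M)\<^sup>2) = 1"
    using assms by (metis density_def trace_mult_dagger)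
  then have "(norm ?M)\<^sup>2 = 1" by (simp only: of_real_eq_1_iff)
  then have "norm ?M = 1" by (simp add: abs_square_eq_1)
  then show thesis using that M A by blast
qed

text \<open>Compactness follows from this description as the continuous image of a sphere.\<close>

lemma densities_eq_image:
  "{A :: complex^'i^'i. density A} = (\<lambda>M. M ** dagger M) ` sphere (0 :: complex^'i^'i) 1"
proof (intro equalityI subsetI)
  fix A :: "complex^'i^'i"
  assume "A \<in> {A. density A}"
  then have "density A" by simp
  then obtain M :: "complex^'i^'i" where M: "norm M = 1" "A = M ** dagger M"
    by (rule density_eq_square) blast
  have "M \<in> sphere 0 1" using M(1) by simp
  then show "A \<in> (\<lambda>M. M ** dagger M) ` sphere (0 :: complex^'i^'i) 1"
    using M(2) by (rule rev_image_eqI)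
qed (auto simp: density_mult_dagger)

lemma compact_densities: "compact {A. density A}"
  unfolding densities_eq_image
  by (intro compact_continuous_image compact_sphere)
    (simp only: matrix_matrix_mult_def dagger_def vec_lambda_beta, intro continuous_intros)

lemma scaleR_matrix_mult_vec: "(c *\<^sub>R A) *v v = c *\<^sub>R (A *v (v :: complex^'i))"
  by (simp add: matrix_vector_mult_def vec_eq_iff scaleR_sum_right)

lemma psd_scaleR: "psd A \<Longrightarrow> 0 \<le> c \<Longrightarrow> psd (c *\<^sub>R A)"
  and psd_add: "psd A \<Longrightarrow> psd B \<Longrightarrow> psd (A + B)"
  by (auto simp: psd_iff matrix_vector_mult_add_rdistrib inner_add_right scaleR_matrix_mult_vec
      dagger_def vec_eq_iff)

lemma trace_scaleR: "trace (c *\<^sub>R A) = c *\<^sub>R (trace A :: complex)"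
  by (simp add: trace_def scaleR_sum_right)

lemma convex_densities: "convex {A. density A}"
proof (rule convexI)
  fix A B :: "complex^'a^'a" and u v :: real
  assume A: "A \<in> {A. density A}" and B: "B \<in> {A. density A}" and uv: "0 \<le> u" "0 \<le> v" "u + v = 1"
  have "trace (u *\<^sub>R A + v *\<^sub>R B) = complex_of_real (u + v)"
    using A B by (simp add: density_def trace_add trace_scaleR) (simp add: scaleR_conv_of_real)
  then show "u *\<^sub>R A + v *\<^sub>R B \<in> {A. density A}"
    using A B uv psd_add[OF psd_scaleR[of A u] psd_scaleR[of B v]] by (simp add: density_def)
qed

lemma density_maximally_mixed: "density (mat (1 / of_nat CARD('i)) :: complex^'i^'i)"
proof -
  have "mat (1 / of_nat CARD('i)) = (1 / real CARD('i)) *\<^sub>R (mat 1 :: complex^'i^'i)"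
    by (simp add: mat_def vec_eq_iff) (simp add: scaleR_conv_of_real)
  moreover have "psd (mat 1 :: complex^'i^'i)"
    by (auto simp: psd_iff dagger_def mat_def vec_eq_iff) (simp add: mat_def[symmetric])
  ultimately show ?thesis
    by (simp add: density_def psd_scaleR trace_scaleR trace_I) (simp add: scaleR_conv_of_real)
qed

section \<open>Partial traces and permutation invariance\<close>

lemma first_factors_inj:
  assumes "CARD('t::{finite,linorder}) \<le> CARD('n::{finite,linorder})"
  shows "inj (first_factors :: 't \<Rightarrow> 'n)"
proof (rule injI)
  fix i j :: 't
  assume eq: "first_factors i = (first_factors j :: 'n)"
  have less: "card {k. k < i} < CARD('n)" for i :: 't
  proof -
    have "card {k. k < i} < CARD('t)"
      by (rule psubset_card_mono) auto
    then show ?thesis using assms by simp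
  qed
  have "card {k. k < i} = card {k. k < j}"
    using eq less[of i] less[of j] by (simp add: first_factors_def nth_eq_iff_index_eq)
  moreover have "card {k. k < i} < card {k. k < j}" if "i < j" for i j :: 't
    using that by (intro psubset_card_mono) (auto intro: less_trans)
  ultimately show "i = j" by (metis less_irrefl linorder_neqE)
qed

lemma marginal_entry:
  "(marginal \<sigma> :: complex^('t::{finite,linorder} \<Rightarrow> 'd::finite)^('t \<Rightarrow> 'd)) $ \<alpha> $ \<beta>
    = (\<Sum>(x, y)\<in>UNIV. if x \<circ> first_factors = \<alpha> \<and> y \<circ> first_factors = \<beta> \<and>
       (\<forall>k. k \<notin> range (first_factors :: 't \<Rightarrow> 'n::{finite,linorder}) \<longrightarrow> x k = y k) then \<sigma> $ x $ y else 0)"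
proof -
  let ?S = "{(x, y). x \<circ> first_factors = \<alpha> \<and> y \<circ> first_factors = \<beta> \<and>
       (\<forall>k. k \<notin> range (first_factors :: 't \<Rightarrow> 'n) \<longrightarrow> x k = y k)}"
  have "(marginal \<sigma> :: complex^('t \<Rightarrow> 'd)^('t \<Rightarrow> 'd)) $ \<alpha> $ \<beta>
     = (\<Sum>z\<in>?S. \<sigma> $ fst z $ snd z)"
    by (simp add: marginal_def case_prod_beta)
  also have "\<dots> = (\<Sum>z\<in>UNIV. if z \<in> ?S then \<sigma> $ fst z $ snd z else 0)"
    using sum.inter_restrict[of UNIV "\<lambda>z. \<sigma> $ fst z $ snd z" ?S] by simp
  finally show ?thesis by (simp add: case_prod_beta)
qed

lemma dagger_marginal:
  assumes "dagger \<sigma> = \<sigma>"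
  shows "dagger (marginal \<sigma> :: complex^('t::{finite,linorder} \<Rightarrow> 'd::finite)^('t \<Rightarrow> 'd)) = marginal \<sigma>"
proof -
  have "cnj ((marginal \<sigma> :: complex^('t \<Rightarrow> 'd)^('t \<Rightarrow> 'd)) $ \<beta> $ \<alpha>) = marginal \<sigma> $ \<alpha> $ \<beta>" for \<alpha> \<beta>
    unfolding marginal_entry cnj_sum
    by (rule sum.reindex_bij_witness[of _ prod.swap prod.swap])
      (auto simp: cnj_entry_hermitian[OF assms])
  then show ?thesis by (simp add: dagger_def vec_eq_iff)
qed

text \<open>The partial trace is adjoint to tensoring with the identity: the right-hand side is Re
  tr ((H \<otimes> 1) \<sigma>), with H on the first factors.\<close>

lemma inner_hermitian_marginal:
  fixes \<sigma> :: "complex^('n::{finite,linorder} \<Rightarrow> 'd::finite)^('n \<Rightarrow> 'd)"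
    and H :: "complex^('t::{finite,linorder} \<Rightarrow> 'd)^('t \<Rightarrow> 'd)"
  assumes "dagger H = H"
  shows "inner H (marginal \<sigma>) = Re (\<Sum>x\<in>UNIV. \<Sum>y\<in>UNIV.
    if \<forall>k. k \<notin> range (first_factors :: 't \<Rightarrow> 'n) \<longrightarrow> x k = y k
    then H $ (x \<circ> first_factors) $ (y \<circ> first_factors) * \<sigma> $ y $ x else 0)"
proof -
  let ?P = "\<lambda>z. \<forall>k. k \<notin> range (first_factors :: 't \<Rightarrow> 'n) \<longrightarrow> fst z k = snd z k"
  let ?g = "\<lambda>z :: ('n \<Rightarrow> 'd) \<times> ('n \<Rightarrow> 'd). (fst z \<circ> first_factors, snd z \<circ> first_factors) :: ('t \<Rightarrow> 'd) \<times> ('t \<Rightarrow> 'd)"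
  have "(\<Sum>i\<in>UNIV. \<Sum>j\<in>UNIV. H $ i $ j * marginal \<sigma> $ j $ i)
      = (\<Sum>p\<in>UNIV. H $ snd p $ fst p * marginal \<sigma> $ fst p $ snd p)"
    by (subst sum.swap) (simp add: sum.cartesian_product case_prod_beta)
  also have "\<dots> = (\<Sum>p\<in>UNIV. \<Sum>z\<in>UNIV. if ?g z = p then (if ?P z then H $ snd p $ fst p * \<sigma> $ fst z $ snd z else 0) else 0)"
    by (simp add: marginal_entry sum_distrib_left case_prod_beta prod_eq_iff)
      (intro sum.cong, auto)
  also have "\<dots> = (\<Sum>z\<in>UNIV. if ?P z then H $ (snd z \<circ> first_factors) $ (fst z \<circ> first_factors) * \<sigma> $ fst z $ snd z else 0)"
    by (subst sum.swap) (simp cong: if_cong)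
  also have "\<dots> = (\<Sum>x\<in>UNIV. \<Sum>y\<in>UNIV. if \<forall>k. k \<notin> range (first_factors :: 't \<Rightarrow> 'n) \<longrightarrow> x k = y k
    then H $ (x \<circ> first_factors) $ (y \<circ> first_factors) * \<sigma> $ y $ x else 0)"
    by (subst sum.swap) (simp add: sum.cartesian_product case_prod_beta eq_commute)
  finally show ?thesis by (simp only: inner_hermitian_matrix[OF assms])
qed

lemma perm_op_conj_entry:
  fixes A :: "complex^('n::finite \<Rightarrow> 'd::finite)^('n \<Rightarrow> 'd)"
  assumes "bij \<pi>"
  shows "(perm_op \<pi> ** A ** dagger (perm_op \<pi>)) $ x $ y = A $ (x \<circ> \<pi>) $ (y \<circ> \<pi>)"
proof -
  have iff: "x = z \<circ> inv \<pi> \<longleftrightarrow> z = x \<circ> \<pi>" for x z :: "'n \<Rightarrow> 'd"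
    using assms by (auto simp: fun_eq_iff bij_def surj_f_inv_f)
  have "(perm_op \<pi> ** A) $ x $ z = A $ (x \<circ> \<pi>) $ z" for z
    by (simp add: matrix_matrix_mult_def perm_op_def iff if_distrib[of "\<lambda>z. z * _"] cong: if_cong)
  moreover have dag: "dagger (perm_op \<pi>) $ z $ y = (if z = y \<circ> \<pi> then 1 else 0)" for z
    by (simp add: perm_op_def dagger_def iff)
  ultimately show ?thesis
    by (simp add: matrix_matrix_mult_def[of "perm_op \<pi> ** A"] dag if_distrib[of "\<lambda>z. _ * z"]
        cong: if_cong)
qed

lemma perm_invariant_iff:
  "perm_invariant \<sigma> \<longleftrightarrow> (\<forall>\<pi>. bij \<pi> \<longrightarrow> (\<forall>x y. \<sigma> $ (x \<circ> \<pi>) $ (y \<circ> \<pi>) = \<sigma> $ x $ y))"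
proof -
  have "\<pi> permutes UNIV \<longleftrightarrow> bij \<pi>" for \<pi> :: "'a \<Rightarrow> 'a"
    by (auto simp: permutes_def bij_iff)
  then show ?thesis
    by (auto simp: perm_invariant_def vec_eq_iff perm_op_conj_entry)
qed

lemma perm_op_unitary:
  assumes "bij \<pi>"
  shows "dagger (perm_op \<pi>) ** perm_op \<pi> = (mat 1 :: complex^('n::finite \<Rightarrow> 'd::finite)^('n \<Rightarrow> 'd))"
proof -
  have inj: "x \<circ> inv \<pi> = y \<circ> inv \<pi> \<longleftrightarrow> x = y" for x y :: "'n \<Rightarrow> 'd"
    using assms by (auto simp: fun_eq_iff) (metis bij_def inv_f_f)
  have "(dagger (perm_op \<pi>) ** perm_op \<pi>) $ x $ y = (if x = y then 1 else 0)" for x y :: "'n \<Rightarrow> 'd"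
    by (simp add: matrix_matrix_mult_def perm_op_def dagger_def inj if_distrib[of cnj]
        if_distrib[of "\<lambda>z. z * _"] cong: if_cong)
  then show ?thesis
    by (simp add: mat_def vec_eq_iff)
qed

text \<open>Conjugating M by a permutation unitary gives another positive square root of the same
  invariant matrix, so uniqueness identifies it with M.\<close>

lemma perm_invariant_psd_sqrt:
  assumes M: "psd M" and inv: "perm_invariant (M ** M)"
  shows "perm_invariant M"
proof -
  have "perm_op \<pi> ** M ** dagger (perm_op \<pi>) = M" if \<pi>: "\<pi> permutes UNIV" for \<pi>
  proof (rule psd_square_inj)
    let ?U = "perm_op \<pi> :: complex^('a \<Rightarrow> 'b)^('a \<Rightarrow> 'b)"
    have U: "dagger ?U ** ?U = mat 1"
      using \<pi> by (intro perm_op_unitary) (rule permutes_bij)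
    have "inner v ((?U ** M ** dagger ?U) *v v) = inner (dagger ?U *v v) (M *v (dagger ?U *v v))" for v
      by (simp add: matrix_vector_mul_assoc[symmetric] inner_matrix_vector[of v ?U])
    then show "psd (?U ** M ** dagger ?U)"
      using M by (simp add: psd_iff dagger_mult matrix_mul_assoc)
    show "psd M" by fact
    have "(?U ** M ** dagger ?U) ** (?U ** M ** dagger ?U) = ?U ** M ** (dagger ?U ** ?U) ** M ** dagger ?U"
      by (simp only: matrix_mul_assoc)
    also have "\<dots> = ?U ** (M ** M) ** dagger ?U"
      by (simp add: U matrix_mul_assoc)
    also have "\<dots> = M ** M"
      using inv \<pi> by (simp add: perm_invariant_def)
    finally show "(?U ** M ** dagger ?U) ** (?U ** M ** dagger ?U) = M ** M" .
  qed
  then show ?thesis by (simp add: perm_invariant_def)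
qed

section \<open>Purification and separation\<close>

definition two :: "'a \<Rightarrow> 'a \<Rightarrow> 2 \<Rightarrow> 'a" where
  "two p q = (\<lambda>i. if i = 1 then p else q)"

lemma two_apply [simp]: "two p q 1 = p" "two p q 2 = q"
  by (simp_all add: two_def)

lemma two_eta [simp]: "two (f 1) (f 2) = f"
proof
  fix i :: 2 show "two (f 1) (f 2) i = f i"
    using exhaust_2[of i] by auto
qed

text \<open>The operator \<open>H \<otimes> 1\<close> on two sites of \<open>\<complex>\<^sup>d \<otimes> \<complex>\<^sup>d\<close>, where the second tensor factor of each site is the
  purifying environment.\<close>

definition with_environment ::
  "complex^(2 \<Rightarrow> 'd::finite)^(2 \<Rightarrow> 'd) \<Rightarrow> complex^(('d \<times> 'd) \<times> ('d \<times> 'd))^(('d \<times> 'd) \<times> ('d \<times> 'd))" where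
  "with_environment H = (\<chi> r s. if snd (fst r) = snd (fst s) \<and> snd (snd r) = snd (snd s)
     then H $ two (fst (fst r)) (fst (snd r)) $ two (fst (fst s)) (fst (snd s)) else 0)"

lemma dagger_with_environment:
  assumes "dagger H = H"
  shows "dagger (with_environment H) = with_environment H"
  by (auto simp: dagger_def with_environment_def vec_eq_iff cnj_entry_hermitian[OF assms])

lemma sum_sites_environment:
  fixes F :: "('d::finite \<times> 'd) \<times> ('d \<times> 'd) \<Rightarrow> complex"
  shows "(\<Sum>r\<in>UNIV. F r) = (\<Sum>e\<in>UNIV. \<Sum>\<alpha>\<in>UNIV. F ((\<alpha> 1, fst e), (\<alpha> (2 :: 2), snd e)))"
proof -
  have "(\<Sum>r\<in>UNIV. F r) = (\<Sum>p\<in>UNIV. F ((snd p 1, fst (fst p)), (snd p (2 :: 2), snd (fst p))))"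
    by (rule sum.reindex_bij_witness[of _
        "\<lambda>p. ((snd p 1, fst (fst p)), (snd p (2 :: 2), snd (fst p)))"
        "\<lambda>r. ((snd (fst r), snd (snd r)), two (fst (fst r)) (fst (snd r)))"]) auto
  then show ?thesis
    by (simp add: sum.cartesian_product case_prod_beta)
qed

lemma cip_with_environment:
  "cip v (with_environment H *v v) = (\<Sum>e\<in>UNIV. \<Sum>\<alpha>\<in>UNIV. \<Sum>\<beta>\<in>UNIV.
    cnj (v $ ((\<alpha> 1, fst e), (\<alpha> 2, snd e))) * H $ \<alpha> $ \<beta> * v $ ((\<beta> 1, fst e), (\<beta> 2, snd e)))"
proof -
  have "(with_environment H *v v) $ ((\<alpha> 1, fst e), (\<alpha> 2, snd e))
      = (\<Sum>\<beta>\<in>UNIV. H $ \<alpha> $ \<beta> * v $ ((\<beta> 1, fst e), (\<beta> 2, snd e)))" for \<alpha> :: "2 \<Rightarrow> 'a" and e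
  proof -
    have "(with_environment H *v v) $ ((\<alpha> 1, fst e), (\<alpha> 2, snd e))
      = (\<Sum>e'\<in>UNIV. \<Sum>\<beta>\<in>UNIV. if e' = e then H $ \<alpha> $ \<beta> * v $ ((\<beta> 1, fst e'), (\<beta> 2, snd e')) else 0)"
      unfolding matrix_vector_mult_def vec_lambda_beta sum_sites_environment
      by (intro sum.cong[OF refl]) (auto simp: with_environment_def prod_eq_iff)
    also have "\<dots> = (\<Sum>\<beta>\<in>UNIV. H $ \<alpha> $ \<beta> * v $ ((\<beta> 1, fst e), (\<beta> 2, snd e)))"
      by (subst sum.swap) simp
    finally show ?thesis .
  qed
  then show ?thesis
    by (simp add: cip_def sum_sites_environment sum_distrib_left mult.assoc)
qed

lemma inner_rank_one:
  assumes "dagger H = H"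
  shows "inner H (\<chi> i j. v $ i * cnj (v $ j)) = inner v (H *v v)"
  by (simp add: inner_hermitian_matrix[OF assms] inner_eq_Re_cip cip_def matrix_vector_mult_def
      sum_distrib_left mult_ac)

lemma density_rank_one:
  fixes v :: "complex^'i"
  assumes "norm v = 1"
  shows "density (\<chi> i j. v $ i * cnj (v $ j))"
proof -
  have "trace (\<chi> i j. v $ i * cnj (v $ j)) = cip v v"
    by (simp add: trace_def cip_def mult.commute)
  moreover have "0 \<le> inner w ((\<chi> i j. v $ i * cnj (v $ j)) *v w)" for w
  proof -
    have "(\<chi> i j. v $ i * cnj (v $ j)) *v w = cip v w *s v"
      by (simp add: matrix_vector_mult_def cip_def vec_eq_iff sum_distrib_left mult_ac)
    then have "inner w ((\<chi> i j. v $ i * cnj (v $ j)) *v w) = Re (cip v w * cnj (cip v w))"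
      by (simp add: inner_eq_Re_cip cip_scale_right cip_commute[of w v])
    then show ?thesis
      by (simp add: complex_norm_square[symmetric] del: of_real_power)
  qed
  ultimately show ?thesis
    using assms by (simp add: density_def psd_iff cip_self) (simp add: dagger_def vec_eq_iff)
qed

lemma quadratic_form_range:
  fixes H :: "complex^'i^'i"
  assumes H: "dagger H = H" and range: "\<And>\<omega>. density \<omega> \<Longrightarrow> l \<le> inner H \<omega> \<and> inner H \<omega> \<le> r"
  shows "l * (norm v)\<^sup>2 \<le> inner v (H *v v) \<and> inner v (H *v v) \<le> r * (norm v)\<^sup>2"
proof (cases "v = 0")
  case False
  define w where "w = v /\<^sub>R norm v"
  have "norm w = 1" using False by (simp add: w_def)
  then have "l \<le> inner w (H *v w) \<and> inner w (H *v w) \<le> r"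
    using range[OF density_rank_one] inner_rank_one[OF H] by metis
  moreover have "inner v (H *v v) = (norm v)\<^sup>2 * inner w (H *v w)"
    using False by (simp add: w_def linear_scale[OF linear_matrix_vector] power2_eq_square field_simps)
  ultimately show ?thesis
    by (auto simp: mult.commute[of _ "(norm v)\<^sup>2"] intro!: mult_left_mono)
qed simp

text \<open>H \<otimes> 1 is block diagonal over the environment index, with a copy of H in each
  block. The slices \<open>w e\<close> of \<open>v\<close> carry the total squared norm.\<close>

lemma with_environment_range:
  fixes H :: "complex^(2 \<Rightarrow> 'd::finite)^(2 \<Rightarrow> 'd)"
  assumes H: "dagger H = H" and range: "\<And>\<omega>. density \<omega> \<Longrightarrow> l \<le> inner H \<omega> \<and> inner H \<omega> \<le> r"
  shows "l * (norm v)\<^sup>2 \<le> inner v (with_environment H *v v) \<and>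
    inner v (with_environment H *v v) \<le> r * (norm v)\<^sup>2"
proof -
  define w where "w e = (\<chi> \<alpha>. v $ ((\<alpha> 1, fst e), (\<alpha> (2::2), snd e)))" for e
  have "cip v (with_environment H *v v) = (\<Sum>e\<in>UNIV. cip (w e) (H *v w e))"
    by (simp add: cip_with_environment) (simp add: cip_def w_def matrix_vector_mult_def sum_distrib_left mult_ac)
  then have inner: "inner v (with_environment H *v v) = (\<Sum>e\<in>UNIV. inner (w e) (H *v w e))"
    by (simp add: inner_eq_Re_cip)
  have "cip v v = (\<Sum>e\<in>UNIV. cip (w e) (w e))"
    by (simp add: cip_def sum_sites_environment w_def)
  then have "complex_of_real ((norm v)\<^sup>2) = complex_of_real (\<Sum>e\<in>UNIV. (norm (w e))\<^sup>2)"
    by (simp only: cip_self of_real_sum)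
  then have norm: "(norm v)\<^sup>2 = (\<Sum>e\<in>UNIV. (norm (w e))\<^sup>2)"
    by (simp only: of_real_eq_iff)
  show ?thesis
    unfolding inner norm sum_distrib_left
    using quadratic_form_range[OF H range] by (auto intro!: sum_mono)
qed

text \<open>Reshape \<open>w\<close> into a matrix W indexed by system and environment. Tracing the
  environment out of w \<otimes> w leaves the tensor square of \<omega> = W W^*, so product vectors
  of the enlarged sites have only energies of tensor-power states.\<close>

lemma with_environment_product:
  fixes H :: "complex^(2 \<Rightarrow> 'd::finite)^(2 \<Rightarrow> 'd)" and w :: "complex^('d \<times> 'd)"
  assumes H: "dagger H = H" and w: "norm w = 1"
  obtains \<omega> where "density \<omega>"
    "inner (tensor_square w) (with_environment H *v tensor_square w) = inner H (tensor_power \<omega>)"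
proof -
  define W where "W = (\<chi> p s. w $ (p, s))"
  have "cip w w = (\<Sum>p\<in>UNIV. cip (W $ p) (W $ p))"
    by (simp add: cip_def W_def sum.cartesian_product case_prod_beta)
  then have "complex_of_real ((norm W)\<^sup>2) = complex_of_real ((norm w)\<^sup>2)"
    by (simp only: trace_mult_dagger[symmetric] cip_self[symmetric])
      (simp add: cip_def trace_def matrix_matrix_mult_def dagger_def mult.commute)
  then have "norm W = 1"
    using w by (simp only: of_real_eq_iff) (simp add: abs_square_eq_1)
  then have dens: "density (W ** dagger W)" by (rule density_mult_dagger)
  have tp: "(tensor_power (W ** dagger W) :: complex^(2 \<Rightarrow> 'd)^(2 \<Rightarrow> 'd)) $ \<beta> $ \<alpha>
     = (\<Sum>e\<in>UNIV. w $ (\<beta> 1, fst e) * cnj (w $ (\<alpha> 1, fst e)) * (w $ (\<beta> 2, snd e) * cnj (w $ (\<alpha> 2, snd e))))"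
    for \<alpha> \<beta>
    by (simp add: tensor_power_def UNIV_2 matrix_matrix_mult_def dagger_def W_def sum_product
        sum.cartesian_product case_prod_beta)
  have "cip (tensor_square w) (with_environment H *v tensor_square w)
      = (\<Sum>e\<in>UNIV. \<Sum>\<alpha>\<in>UNIV. \<Sum>\<beta>\<in>UNIV. H $ \<alpha> $ \<beta> *
         (w $ (\<beta> 1, fst e) * cnj (w $ (\<alpha> 1, fst e)) * (w $ (\<beta> 2, snd e) * cnj (w $ (\<alpha> 2, snd e)))))"
    by (simp add: cip_with_environment tensor_square_def mult_ac)
  also have "\<dots> = (\<Sum>\<alpha>\<in>UNIV. \<Sum>\<beta>\<in>UNIV. H $ \<alpha> $ \<beta> * tensor_power (W ** dagger W) $ \<beta> $ \<alpha>)"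
    unfolding tp sum_distrib_left
    by (subst sum.swap, rule sum.cong[OF refl], rule sum.swap)
  finally show thesis
    using that[OF dens] by (simp add: inner_eq_Re_cip inner_hermitian_matrix[OF H])
qed

section \<open>Symmetric purification\<close>

text \<open>The vectorisation of M, with the k-th row and k-th column indices grouped into site k. A
  permutation of sites then acts on rows and columns simultaneously, so invariance of M becomes
  symmetry of the vector.\<close>

definition purification :: "complex^('n::finite \<Rightarrow> 'd::finite)^('n \<Rightarrow> 'd) \<Rightarrow> complex^('n \<Rightarrow> 'd \<times> 'd)" where
  "purification M = (\<chi> x. M $ (fst \<circ> x) $ (snd \<circ> x))"

lemma sum_pair_valued:
  fixes F :: "('n::finite \<Rightarrow> 'd::finite) \<Rightarrow> ('n \<Rightarrow> 'd) \<Rightarrow> complex"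
  shows "(\<Sum>x\<in>UNIV. F (fst \<circ> x) (snd \<circ> x)) = (\<Sum>x\<in>UNIV. \<Sum>z\<in>UNIV. F x z)"
proof -
  have "(\<Sum>x\<in>UNIV. F (fst \<circ> x) (snd \<circ> x)) = (\<Sum>p\<in>UNIV. F (fst p) (snd p))"
    by (rule sum.reindex_bij_witness[of _ "\<lambda>p k. (fst p k, snd p k)" "\<lambda>x. (fst \<circ> x, snd \<circ> x)"])
      (auto simp: comp_def)
  then show ?thesis
    by (simp add: sum.cartesian_product case_prod_beta)
qed

lemma norm_purification: "norm (purification M) = norm M"
proof -
  have "complex_of_real ((norm (purification M))\<^sup>2) = cip (purification M) (purification M)"
    by (rule cip_self[symmetric])
  also have "\<dots> = (\<Sum>x\<in>UNIV. \<Sum>z\<in>UNIV. cnj (M $ x $ z) * M $ x $ z)"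
    by (simp add: cip_def purification_def sum_pair_valued[of "\<lambda>x z. cnj (M $ x $ z) * M $ x $ z"])
  also have "\<dots> = trace (M ** dagger M)"
    by (simp add: trace_def matrix_matrix_mult_def dagger_def mult.commute)
  also have "\<dots> = complex_of_real ((norm M)\<^sup>2)"
    by (rule trace_mult_dagger)
  finally show ?thesis
    by (simp only: of_real_eq_iff power2_eq_iff_nonneg norm_ge_zero)
qed

lemma sym_tensor_purification:
  "perm_invariant M \<Longrightarrow> sym_tensor (purification M)"
  by (simp add: perm_invariant_iff sym_tensor_def purification_def flip: comp_assoc)

text \<open>The operator is the identity on every environment factor, so the sum over the
  environment turns two copies of M into M M^*.\<close>

lemma cip_purification:
  assumes "a \<noteq> b"
  shows "cip (purification M) (lift_pair a b (with_environment H) *v purification M)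
    = (\<Sum>x\<in>UNIV. \<Sum>y\<in>UNIV. if \<forall>k. k \<noteq> a \<longrightarrow> k \<noteq> b \<longrightarrow> x k = y k
       then H $ two (x a) (x b) $ two (y a) (y b) * (M ** dagger M) $ y $ x else 0)"
proof -
  let ?P = "\<lambda>x y. \<forall>k. k \<noteq> a \<longrightarrow> k \<noteq> b \<longrightarrow> x k = y k"
  let ?h = "\<lambda>x y. if ?P x y then H $ two (x a) (x b) $ two (y a) (y b) else 0"
  have lift: "lift_pair a b (with_environment H) $ x $ y
      = (if snd \<circ> y = snd \<circ> x then ?h (fst \<circ> x) (fst \<circ> y) else 0)" for x y
  proof -
    have iff: "snd \<circ> y = snd \<circ> x \<and> ?P (fst \<circ> x) (fst \<circ> y) \<longleftrightarrow>
        ?P x y \<and> snd (x a) = snd (y a) \<and> snd (x b) = snd (y b)"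
    proof safe
      assume P: "?P x y" "snd (x a) = snd (y a)" "snd (x b) = snd (y b)"
      show "snd \<circ> y = snd \<circ> x"
      proof
        fix k show "(snd \<circ> y) k = (snd \<circ> x) k"
          using P by (cases "k = a"; cases "k = b") auto
      qed
    qed (auto simp: prod_eq_iff fun_eq_iff)
    let ?H = "H $ two ((fst \<circ> x) a) ((fst \<circ> x) b) $ two ((fst \<circ> y) a) ((fst \<circ> y) b)"
    have "lift_pair a b (with_environment H) $ x $ y
        = (if ?P x y \<and> snd (x a) = snd (y a) \<and> snd (x b) = snd (y b) then ?H else 0)"
      by (auto simp: lift_pair_def with_environment_def)
    also have "\<dots> = (if snd \<circ> y = snd \<circ> x \<and> ?P (fst \<circ> x) (fst \<circ> y) then ?H else 0)"
      by (simp only: iff)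
    finally show ?thesis
      by (cases "snd \<circ> y = snd \<circ> x") (simp_all only: simp_thms if_True if_False)
  qed
  have vec: "(lift_pair a b (with_environment H) *v purification M) $ x
      = (\<Sum>y\<in>UNIV. ?h (fst \<circ> x) y * M $ y $ (snd \<circ> x))" for x
  proof -
    have "(lift_pair a b (with_environment H) *v purification M) $ x
      = (\<Sum>y\<in>UNIV. if snd \<circ> y = snd \<circ> x then ?h (fst \<circ> x) (fst \<circ> y) * M $ (fst \<circ> y) $ (snd \<circ> y) else 0)"
      unfolding matrix_vector_mult_def lift purification_def vec_lambda_beta
      by (rule sum.cong[OF refl]) simp
    also have "\<dots> = (\<Sum>y\<in>UNIV. \<Sum>z\<in>UNIV. if z = snd \<circ> x then ?h (fst \<circ> x) y * M $ y $ z else 0)"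
      by (rule sum_pair_valued[of "\<lambda>y z. if z = snd \<circ> x then ?h (fst \<circ> x) y * M $ y $ z else 0"])
    finally show ?thesis by simp
  qed
  have "cip (purification M) (lift_pair a b (with_environment H) *v purification M)
     = (\<Sum>x\<in>UNIV. \<Sum>z\<in>UNIV. cnj (M $ x $ z) * (\<Sum>y\<in>UNIV. ?h x y * M $ y $ z))"
    unfolding cip_def vec
    by (simp only: purification_def vec_lambda_beta sum_pair_valued[of "\<lambda>x z. cnj (M $ x $ z) * (\<Sum>y\<in>UNIV. ?h x y * M $ y $ z)"])
  also have "\<dots> = (\<Sum>x\<in>UNIV. \<Sum>y\<in>UNIV. ?h x y * (M ** dagger M) $ y $ x)"
  proof (rule sum.cong[OF refl])
    fix x
    have "(\<Sum>z\<in>UNIV. cnj (M $ x $ z) * (\<Sum>y\<in>UNIV. ?h x y * M $ y $ z))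
        = (\<Sum>z\<in>UNIV. \<Sum>y\<in>UNIV. ?h x y * (M $ y $ z * cnj (M $ x $ z)))"
      by (simp only: sum_distrib_left mult_ac)
    also have "\<dots> = (\<Sum>y\<in>UNIV. \<Sum>z\<in>UNIV. ?h x y * (M $ y $ z * cnj (M $ x $ z)))"
      by (rule sum.swap)
    finally show "(\<Sum>z\<in>UNIV. cnj (M $ x $ z) * (\<Sum>y\<in>UNIV. ?h x y * M $ y $ z))
        = (\<Sum>y\<in>UNIV. ?h x y * (M ** dagger M) $ y $ x)"
      by (simp only: matrix_matrix_mult_def dagger_def vec_lambda_beta sum_distrib_left)
  qed
  also have "\<dots> = (\<Sum>x\<in>UNIV. \<Sum>y\<in>UNIV. if ?P x y
       then H $ two (x a) (x b) $ two (y a) (y b) * (M ** dagger M) $ y $ x else 0)"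
    by (intro sum.cong[OF refl]) auto
  finally show ?thesis .
qed

text \<open>The energy bound applied to the purification by the positive square root. Its sites have
  dimension D = d^2, the source of d^2 - 1 in the constant.\<close>

lemma exchangeable_marginal_bound:
  fixes \<sigma> :: "complex^('n::{finite,linorder} \<Rightarrow> 'd::finite)^('n \<Rightarrow> 'd)"
    and H :: "complex^(2 \<Rightarrow> 'd)^(2 \<Rightarrow> 'd)"
  assumes N: "2 \<le> CARD('n)" and \<sigma>: "density \<sigma>" "perm_invariant \<sigma>" and H: "dagger H = H"
    and range: "\<And>\<omega>. density \<omega> \<Longrightarrow> l \<le> inner H \<omega> \<and> inner H \<omega> \<le> r"
    and prod: "\<And>\<omega>. density \<omega> \<Longrightarrow> inner H (tensor_power \<omega>) \<le> e"
  shows "inner H (marginal \<sigma>) \<le> e + (r - l) * sqrt (real CARD('d) ^ 2 - 1) / (2 * (real CARD('n) - 1))"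
proof -
  \<comment> \<open>In the type \<open>2\<close> the numeral \<open>2\<close> equals
    \<open>0\<close>, so \<open>b\<close> is the first factor and \<open>a\<close> the second. The
    labels stay consistent, as \<open>comp\<close> matches index \<open>1\<close> with
    \<open>a\<close> and index \<open>2\<close> with \<open>b\<close>.\<close>
  define a where "a = (first_factors (1 :: 2) :: 'n)"
  define b where "b = (first_factors (2 :: 2) :: 'n)"
  have "inj (first_factors :: 2 \<Rightarrow> 'n)"
    using N by (intro first_factors_inj) simp
  then have ab: "a \<noteq> b"
    by (auto simp: a_def b_def inj_eq)
  have range_eq: "range (first_factors :: 2 \<Rightarrow> 'n) = {a, b}"
    by (simp add: UNIV_2 a_def b_def)
  have comp: "x \<circ> first_factors = two (x a) (x b)" for x :: "'n \<Rightarrow> 'd"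
    using two_eta[of "x \<circ> first_factors"] by (simp add: a_def b_def)
  obtain M where M: "psd M" "norm M = 1" "\<sigma> = M ** dagger M"
    using density_eq_square[OF \<sigma>(1)] by blast
  have "perm_invariant M"
  proof (rule perm_invariant_psd_sqrt[OF M(1)])
    have "dagger M = M" using M(1) by (simp add: psd_def)
    then show "perm_invariant (M ** M)" using M(3) \<sigma>(2) by simp
  qed
  then have sym: "sym_tensor (purification M)"
    by (rule sym_tensor_purification)
  have "inner H (marginal \<sigma>)
      = inner (purification M) (lift_pair a b (with_environment H) *v purification M)"
    unfolding inner_hermitian_marginal[OF H] inner_eq_Re_cip cip_purification[OF ab] range_eq comp M(3)
    by (simp add: imp_conjL)
  also have "\<dots> \<le> e + (r - l) * sqrt (real CARD('d \<times> 'd) - 1) / (2 * (real CARD('n) - 1))"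
  proof (rule symmetric_pair_energy_bound[OF ab dagger_with_environment[OF H] _ _ _ sym])
    fix w :: "complex^('d \<times> 'd)"
    assume "norm w = 1"
    then obtain \<omega> where "density \<omega>"
      "inner (tensor_square w) (with_environment H *v tensor_square w) = inner H (tensor_power \<omega>)"
      using with_environment_product[OF H] by blast
    then show "inner (tensor_square w) (with_environment H *v tensor_square w) \<le> e"
      using prod by simp
  qed (use with_environment_range[OF H range] M in \<open>auto simp: norm_purification\<close>)
  finally show ?thesis by (simp add: power2_eq_square)
qed

lemma dagger_tensor_power:
  assumes "dagger \<omega> = \<omega>"
  shows "dagger (tensor_power \<omega>) = tensor_power \<omega>"
  by (simp add: dagger_def tensor_power_def vec_eq_iff cnj_entry_hermitian[OF assms])

lemma compact_SEP2: "compact (SEP2 :: (complex^(2 \<Rightarrow> 'd::finite)^(2 \<Rightarrow> 'd)) set)"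
proof -
  have "SEP2 = convex hull (tensor_power ` {\<omega> :: complex^'d^'d. density \<omega>} :: (complex^(2 \<Rightarrow> 'd)^(2 \<Rightarrow> 'd)) set)"
    unfolding SEP2_def by (intro arg_cong[of _ _ "\<lambda>S. convex hull S"]) auto
  moreover have "continuous_on {\<omega> :: complex^'d^'d. density \<omega>} (tensor_power :: _ \<Rightarrow> complex^(2 \<Rightarrow> 'd)^(2 \<Rightarrow> 'd))"
    unfolding tensor_power_def by (intro continuous_intros)
  then have "compact (convex hull (tensor_power ` {\<omega> :: complex^'d^'d. density \<omega>} :: (complex^(2 \<Rightarrow> 'd)^(2 \<Rightarrow> 'd)) set))"
    by (rule compact_convex_hull[OF compact_continuous_image[OF _ compact_densities]])
  ultimately show ?thesis by simp
qed

section \<open>Separation by a Hermitian functional\<close>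

text \<open>The maximum of \<open>inner H\<close> over c (D - D) is c (r - l), which is exactly the
  error term of \<open>exchangeable_marginal_bound\<close>. Hence no Hermitian H can separate \<rho>
  from C.\<close>

lemma EXCH2_approximation:
  fixes \<rho> :: "complex^(2 \<Rightarrow> 'd::finite)^(2 \<Rightarrow> 'd)"
  assumes N: "2 \<le> CARD('n::{finite,linorder})" and \<rho>: "\<rho> \<in> EXCH2 TYPE('n)"
  obtains \<tau> \<omega>1 \<omega>2 where "\<tau> \<in> SEP2" "density \<omega>1" "density \<omega>2"
    "\<rho> = \<tau> + (sqrt (real CARD('d) ^ 2 - 1) / (2 * (real CARD('n) - 1))) *\<^sub>R (\<omega>1 - \<omega>2)"
proof -
  define c where "c = sqrt (real CARD('d) ^ 2 - 1) / (2 * (real CARD('n) - 1))"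
  define D where "D = {\<omega> :: complex^(2 \<Rightarrow> 'd)^(2 \<Rightarrow> 'd). density \<omega>}"
  define B where "B = (\<lambda>z. c *\<^sub>R z) ` (\<Union>x\<in>D. \<Union>y\<in>D. {x - y})"
  define C where "C = (\<Union>x\<in>SEP2. \<Union>y\<in>B. {x + y})"
  obtain \<sigma> :: "complex^('n \<Rightarrow> 'd)^('n \<Rightarrow> 'd)" where \<sigma>: "\<rho> = marginal \<sigma>" "density \<sigma>" "perm_invariant \<sigma>"
    using \<rho> by (auto simp: EXCH2_def)
  have compD: "compact D" and convD: "convex D"
    by (simp_all add: D_def compact_densities convex_densities)
  have neD: "D \<noteq> {}"
    using density_maximally_mixed by (auto simp: D_def)
  have "convex C"
    unfolding C_def B_def SEP2_def by (intro convex_sums convex_scaling convex_differences convD convex_convex_hull)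
  moreover have "closed C"
    unfolding C_def B_def
    by (intro compact_imp_closed compact_sums' compact_scaling compact_differences' compD compact_SEP2)
  ultimately have sep: "\<exists>a \<beta>. inner a \<rho> < \<beta> \<and> (\<forall>x\<in>C. inner a x > \<beta>)" if "\<rho> \<notin> C"
    using that by (intro separating_hyperplane_closed_point)
  have "\<rho> \<in> C"
  proof (rule ccontr)
    assume "\<rho> \<notin> C"
    then obtain a \<beta> where a: "inner a \<rho> < \<beta>" "\<And>x. x \<in> C \<Longrightarrow> \<beta> < inner a x"
      using sep by blast
    \<comment> \<open>The Hermitian part of \<open>a\<close> takes the same values on Hermitian
      matrices. The sign is reversed so that \<rho> lies above C instead of below it.\<close>
    define H where "H = - ((1/2) *\<^sub>R (a + dagger a))"
    have H: "dagger H = H"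
      by (simp add: H_def dagger_def vec_eq_iff add.commute)
    have inner_H: "inner H X = - inner a X" if "dagger X = X" for X
      using inner_dagger_hermitian[OF that, of a] by (simp add: H_def inner_add_left)
    have herm: "dagger \<omega> = \<omega>" if "density \<omega>" for \<omega> :: "complex^'i^'i"
      using that by (simp add: density_def psd_def)
    have contH: "continuous_on S (inner H)" for S
      by (intro continuous_intros)
    obtain \<omega>u where u: "\<omega>u \<in> D" "\<And>\<omega>. \<omega> \<in> D \<Longrightarrow> inner H \<omega> \<le> inner H \<omega>u"
      using continuous_attains_sup[OF compD neD contH] by blast
    obtain \<omega>l where l: "\<omega>l \<in> D" "\<And>\<omega>. \<omega> \<in> D \<Longrightarrow> inner H \<omega>l \<le> inner H \<omega>"
      using continuous_attains_inf[OF compD neD contH] by blast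
    have "continuous_on {\<omega> :: complex^'d^'d. density \<omega>} (\<lambda>\<omega>. inner H (tensor_power \<omega>))"
      unfolding tensor_power_def by (intro continuous_intros)
    moreover have "{\<omega> :: complex^'d^'d. density \<omega>} \<noteq> {}"
      using density_maximally_mixed by auto
    ultimately obtain \<omega>e :: "complex^'d^'d" where e: "density \<omega>e"
      "\<And>\<omega>. density \<omega> \<Longrightarrow> inner H (tensor_power \<omega>) \<le> inner H (tensor_power \<omega>e)"
      using continuous_attains_sup[OF compact_densities, of "\<lambda>\<omega>. inner H (tensor_power \<omega>)"] by auto
    \<comment> \<open>Built from the three extremal states, x is a point of C at which H takes the
      value e + c (r - l), the upper bound for its value at \<rho>.\<close>
    define x where "x = tensor_power \<omega>e + c *\<^sub>R (\<omega>u - \<omega>l)"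
    have "tensor_power \<omega>e \<in> (SEP2 :: (complex^(2 \<Rightarrow> 'd)^(2 \<Rightarrow> 'd)) set)"
      unfolding SEP2_def using e(1) by (intro hull_inc) auto
    then have "x \<in> C"
      using u l by (auto simp: C_def B_def x_def)
    then have "inner a \<rho> < inner a x"
      using a by (meson less_trans)
    moreover have "dagger \<rho> = \<rho>"
      using \<sigma> by (simp add: dagger_marginal herm)
    moreover have "inner H x = - inner a x"
      using u l e by (simp add: x_def inner_add_right inner_diff_right inner_H herm D_def dagger_tensor_power
          right_diff_distrib)
    ultimately have "inner H x < inner H \<rho>"
      by (simp add: inner_H)
    moreover have "inner H (marginal \<sigma>) \<le> inner H (tensor_power \<omega>e) +
        (inner H \<omega>u - inner H \<omega>l) * sqrt (real CARD('d) ^ 2 - 1) / (2 * (real CARD('n) - 1))"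
      using N \<sigma>(2,3) H
      by (rule exchangeable_marginal_bound) (use u l e in \<open>auto simp: D_def\<close>)
    then have "inner H \<rho> \<le> inner H x"
      by (simp add: \<sigma>(1) x_def c_def inner_add_right inner_diff_right mult.commute)
    ultimately show False by simp
  qed
  then obtain \<tau> \<omega>1 \<omega>2 where "\<tau> \<in> SEP2" "\<omega>1 \<in> D" "\<omega>2 \<in> D" "\<rho> = \<tau> + c *\<^sub>R (\<omega>1 - \<omega>2)"
    by (auto simp: C_def B_def)
  then show thesis
    using that by (auto simp: D_def c_def)
qed

text \<open>A real supremum is bounded by its upper bounds only over a nonempty set; the maximally
  mixed state supplies an element.\<close>

lemma EXCH2_nonempty: "(EXCH2 TYPE('n::{finite,linorder}) :: (complex^(2 \<Rightarrow> 'd::finite)^(2 \<Rightarrow> 'd)) set) \<noteq> {}"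
proof -
  let ?\<sigma> = "mat (1 / of_nat CARD('n \<Rightarrow> 'd)) :: complex^('n \<Rightarrow> 'd)^('n \<Rightarrow> 'd)"
  have "x \<circ> \<pi> = y \<circ> \<pi> \<longleftrightarrow> x = y" if "bij \<pi>" for x y :: "'n \<Rightarrow> 'd" and \<pi> :: "'n \<Rightarrow> 'n"
    using that by (auto simp: fun_eq_iff) (metis bij_is_surj surj_f_inv_f)
  then have "perm_invariant ?\<sigma>"
    by (auto simp: perm_invariant_iff mat_def)
  then show ?thesis
    using density_maximally_mixed by (auto simp: EXCH2_def)
qed

theorem theorem1p2:
  assumes "CARD('n::{finite,linorder}) \<ge> 2" and "CARD('d::finite) \<ge> 2"
  shows "(SUP \<rho> \<in> (EXCH2 TYPE('n) :: (complex^(2 \<Rightarrow> 'd)^(2 \<Rightarrow> 'd)) set).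
            INF \<tau> \<in> SEP2. 1 / 2 * trace_norm (\<rho> - \<tau>))
         \<le> sqrt (real CARD('d) ^ 2 - 1) / (2 * (real CARD('n) - 1))"
proof (rule cSUP_least[OF EXCH2_nonempty])
  fix \<rho> :: "complex^(2 \<Rightarrow> 'd)^(2 \<Rightarrow> 'd)"
  assume \<rho>: "\<rho> \<in> EXCH2 TYPE('n)"
  define c where "c = sqrt (real CARD('d) ^ 2 - 1) / (2 * (real CARD('n) - 1))"
  obtain \<tau> \<omega>1 \<omega>2 where \<tau>: "\<tau> \<in> SEP2" and \<omega>: "density \<omega>1" "density \<omega>2"
    and eq: "\<rho> = \<tau> + c *\<^sub>R (\<omega>1 - \<omega>2)"
    unfolding c_def using EXCH2_approximation[OF assms(1) \<rho>] by blast
  have c: "0 \<le> c"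
    unfolding c_def using assms by (intro divide_nonneg_nonneg real_sqrt_ge_zero) auto
  \<comment> \<open>The difference is written as two positive matrices of trace c each, so half of
    its trace norm is at most c.\<close>
  have "trace_norm (\<rho> - \<tau>) = trace_norm (c *\<^sub>R \<omega>1 - c *\<^sub>R \<omega>2)"
    by (simp add: eq scaleR_diff_right)
  also have "\<dots> \<le> Re (trace (c *\<^sub>R \<omega>1)) + Re (trace (c *\<^sub>R \<omega>2))"
    using \<omega> c by (intro trace_norm_diff_psd_le psd_scaleR) (auto simp: density_def)
  also have "\<dots> = 2 * c"
    using \<omega> by (simp add: trace_scaleR density_def)
  finally have "1 / 2 * trace_norm (\<rho> - \<tau>) \<le> c" by simp
  \<comment> \<open>A real infimum is below each of its members only if the set is bounded
    below.\<close>
  moreover have "bdd_below ((\<lambda>\<tau>. 1 / 2 * trace_norm (\<rho> - \<tau>)) ` SEP2)"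
    by (intro bdd_belowI2[of _ 0]) (simp add: trace_norm_nonneg)
  ultimately show "(INF \<tau>\<in>SEP2. 1 / 2 * trace_norm (\<rho> - \<tau>)) \<le> sqrt (real CARD('d) ^ 2 - 1) / (2 * (real CARD('n) - 1))"
    unfolding c_def[symmetric] using \<tau> by (meson cINF_lower2)
qed

end
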